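(* Let $a>0$, $m\in\mathbb R$, $M=\frac13(m^2-a^4-2a^{-2})$ with $M\ne0$, let $k=\sqrt{3M}$, and let $f=(x_1,x_2,x_3)^t$ be the hyperbolic affine sphere obtained from the Delaunay-type potential at $\lambda=-i$ (see context). Then for $t=x+iy$ with $x\in\mathbb R\setminus\tilde\Lambda$, $y\in\mathbb R$, $$x_1=A_1\tfrac{\sigma(x+\beta-\alpha)}{\sigma(x+\beta)}e^{\zeta(\alpha)x}\cos(ky)+B_1\tfrac{\sigma(x+\beta+2\alpha)}{\sigma(x+\beta)}e^{-2\zeta(\alpha)x},$$ $$x_2=C_1\tfrac{\sigma(x+\beta-\alpha)}{\sigma(x+\beta)}e^{\zeta(\alpha)x}\cos(ky)+D_1\tfrac{\sigma(x+\beta-\alpha)}{\sigma(x+\beta)}e^{\zeta(\alpha)x}\sin(ky)+E_1\tfrac{\sigma(x+\beta+2\alpha)}{\sigma(x+\beta)}e^{-2\zeta(\alpha)x},$$ $$x_3=C_1\tfrac{\sigma(x+\beta-\alpha)}{\sigma(x+\beta)}e^{\zeta(\alpha)x}\cos(ky)-D_1\tfrac{\sigma(x+\beta-\alpha)}{\sigma(x+\beta)}e^{\zeta(\alpha)x}\sin(ky)+E_1\tfrac{\sigma(x+\beta+2\alpha)}{\sigma(x+\beta)}e^{-2\zeta(\alpha)x},$$ where $$A_1=-\frac{2(m-a^2+a^{-1})\sigma(\beta)}{\sqrt3ak^2\sigma(\beta-\alpha)},\quad B_1=\frac{(m-a^2)(m+a^2+2a^{-1})\sigma(\beta)}{\sqrt3k^2\sigma(\beta+2\alpha)},\quad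 C_1=\frac{(m-a^2-2a^{-1})\sigma(\beta)}{\sqrt3ak^2\sigma(\beta-\alpha)},$$ $$D_1=\frac{\sigma(\beta)}{ak\,\sigma(\beta-\alpha)},\quad E_1=\frac{(m-a^2)(m+a^2-a^{-1})\sigma(\beta)}{\sqrt3k^2\sigma(\beta+2\alpha)}.$$
   Context: $\wp$ is the Weierstrass elliptic function with $(\wp_t)^2=4\wp^3-12M^2\wp+8(M^3+2)$, with fundamental periods $\omega_1,\omega_2$; $\zeta,\sigma$ are the corresponding Weierstrass functions ($\zeta'=-\wp$, $\sigma'/\sigma=\zeta$). $\alpha,\beta$ satisfy $\wp(\beta)=2a^{-2}+M$, $\wp_t(\beta)=4a^{-2}m$, $\wp(\alpha)=M$, $\wp_t(\alpha)=4$. $\tilde\Lambda=\{x\in\mathbb C\mid x+\beta\in\omega_1\mathbb Z+\omega_2\mathbb Z\text{ or }\wp(x+\beta)=M\}$. The surface at $\lambda=-i$: let $X=\begin{pmatrix} m & -a^{-1} & a^2 \\ a^{-1} & 0 & -a^{-1} \\ -a^2 & a^{-1} & -m \end{pmatrix}$ (the Delaunay-type potential matrix $\begin{pmatrix} m & \lambda^{-1}ia^{-1} & \lambda ia^2 \\ \lambda ia^{-1} & 0 & \lambda^{-1}ia^{-1} \\ \lambda^{-1}ia^2 & \lambda ia^{-1} & -m \end{pmatrix}$ at $\lambda=-i$), and let $\tilde\Phi_+^{-1}(t)$ be the solution on $\mathbb C\setminus\tilde\Lambda$ of $$(\tilde\Phi_+^{-1})_t=\tilde\Phi_+^{-1}\begin{pmatrix}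 -\frac{\wp_t(t+\beta)}{\wp(t+\beta)-M} & 0 & -2a^2 \\ -2a^{-1} & 0 & 0 \\ 0 & -2a^{-1} & \frac{\wp_t(t+\beta)}{\wp(t+\beta)-M} \end{pmatrix},\quad\tilde\Phi_+^{-1}(0)=I_3.$$ With $\omega=e^{2\pi i/3}$ and $T=\frac1{\sqrt3}\begin{pmatrix} 1 & 1 & 1 \\ \omega & 1 & \omega^2 \\ \omega^2 & 1 & \omega \end{pmatrix}$, the surface is $f(x+iy)=T\exp((x+iy)X)\,\tilde\Phi_+^{-1}(x)\,(0,1,0)^t$.
   Formalization: The case m = a² is excluded: there β+2α is a period, so σ(β+2α) = 0 and the printed constants B₁ and E₁ are 0/0, hence undefined. *)

theory Defs
  imports "HOL-Analysis.Analysis"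
begin

section \<open>Weierstrass functions of a lattice\<close>

definition period_lattice :: "complex \<Rightarrow> complex \<Rightarrow> complex set" where
  "period_lattice \<omega>\<^sub>1 \<omega>\<^sub>2 = {of_int p * \<omega>\<^sub>1 + of_int q * \<omega>\<^sub>2 | p q. True}"

text \<open>
  The classical series and product expansions. They are meaningful when the lattice is
  discrete of rank 2; the values of \<open>weierstrass_p\<close> and \<open>weierstrass_zeta\<close> at the lattice points
  themselves (the poles) carry no information.
\<close>

definition weierstrass_p :: "complex set \<Rightarrow> complex \<Rightarrow> complex" where
  "weierstrass_p L z = 1 / z^2 + (\<Sum>\<^sub>\<infinity>w\<in>L - {0}. 1 / (z - w)^2 - 1 / w^2)"

definition weierstrass_zeta :: "complex set \<Rightarrow> complex \<Rightarrow> complex" where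
  "weierstrass_zeta L z = 1 / z + (\<Sum>\<^sub>\<infinity>w\<in>L - {0}. 1 / (z - w) + 1 / w + z / w^2)"

text \<open>
  The infinite product is the limit of the finite subproducts along the finite subsets of
  \<open>L - {0}\<close>, that is, the multiplicative counterpart of \<open>infsum\<close>.
\<close>

definition weierstrass_sigma :: "complex set \<Rightarrow> complex \<Rightarrow> complex" where
  "weierstrass_sigma L z =
     z * Lim (finite_subsets_at_top (L - {0}))
           (\<lambda>S. \<Prod>w\<in>S. (1 - z / w) * exp (z / w + (z / w)^2 / 2))"


section \<open>Complex matrices\<close>

definition cscale :: "complex \<Rightarrow> complex^'n^'m \<Rightarrow> complex^'n^'m" where
  "cscale c A = (\<chi> i j. c * A $ i $ j)"

primrec matpow :: "complex^'n^'n \<Rightarrow> nat \<Rightarrow> complex^'n^'n" where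
  "matpow A 0 = mat 1"
| "matpow A (Suc n) = A ** matpow A n"

definition matexp :: "complex^'n^'n \<Rightarrow> complex^'n^'n" where
  "matexp A = (\<Sum>n. (1 / fact n) *\<^sub>R matpow A n)"


section \<open>The surface of the Delaunay-type potential\<close>

definition delaunay_potential :: "real \<Rightarrow> real \<Rightarrow> complex \<Rightarrow> complex^3^3" where
  "delaunay_potential a m lam = vector
     [vector [of_real m,                inverse lam * \<i> / of_real a, lam * \<i> * of_real (a^2)],
      vector [lam * \<i> / of_real a,        0,                          inverse lam * \<i> / of_real a],
      vector [inverse lam * \<i> * of_real (a^2), lam * \<i> / of_real a,      - of_real m]]"

definition delaunay_X :: "real \<Rightarrow> real \<Rightarrow> complex^3^3" where
  "delaunay_X a m = delaunay_potential a m (- \<i>)"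

lemma delaunay_X_explicit:
  "delaunay_X a m = vector
     [vector [of_real m,          - of_real (1 / a), of_real (a^2)],
      vector [of_real (1 / a),    0,                 - of_real (1 / a)],
      vector [- of_real (a^2),    of_real (1 / a),   - of_real m]]"
  by (simp add: delaunay_X_def delaunay_potential_def)

definition Lambda_tilde :: "complex set \<Rightarrow> complex \<Rightarrow> real \<Rightarrow> complex set" where
  "Lambda_tilde L \<beta> M = {x. x + \<beta> \<in> L \<or> weierstrass_p L (x + \<beta>) = of_real M}"

definition frame_coeff :: "complex set \<Rightarrow> complex \<Rightarrow> real \<Rightarrow> real \<Rightarrow> complex \<Rightarrow> complex^3^3" where
  "frame_coeff L \<beta> M a t =
     (let g = deriv (weierstrass_p L) (t + \<beta>) / (weierstrass_p L (t + \<beta>) - of_real M)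
      in vector
     [vector [- g,                   0,                   - of_real (2 * a^2)],
      vector [- of_real (2 / a),     0,                   0],
      vector [0,                     - of_real (2 / a),   g]])"

text \<open>
  \<open>F\<close> plays the role of the inverse positive frame: the solution, holomorphic on the complement of
  \<open>Lambda_tilde\<close>, of a linear matrix ODE in the complex variable, read entrywise. The complement
  of \<open>Lambda_tilde\<close> is connected, so \<open>F\<close> is unique there.
\<close>

definition is_inverse_frame ::
  "complex set \<Rightarrow> complex \<Rightarrow> real \<Rightarrow> real \<Rightarrow> (complex \<Rightarrow> complex^3^3) \<Rightarrow> bool" where
  "is_inverse_frame L \<beta> M a F \<longleftrightarrow>
     F 0 = mat 1 \<and>
     (\<forall>t. t \<notin> Lambda_tilde L \<beta> M \<longrightarrow>
        (\<forall>i j. ((\<lambda>s. F s $ i $ j) has_field_derivative (F t ** frame_coeff L \<beta> M a t) $ i $ j) (at t)))"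

definition T_matrix :: "complex^3^3" where
  "T_matrix =
     (let \<omega> = exp (2 * of_real pi * \<i> / 3)
      in cscale (1 / of_real (sqrt 3)) (vector
     [vector [1,    1,  1],
      vector [\<omega>,    1,  \<omega>^2],
      vector [\<omega>^2,  1,  \<omega>]]))"

text \<open>
  Only the real part \<open>x\<close> of \<open>t = x + \<i> y\<close> enters the frame factor.
\<close>

definition affine_sphere ::
  "real \<Rightarrow> real \<Rightarrow> (complex \<Rightarrow> complex^3^3) \<Rightarrow> complex \<Rightarrow> complex^3" where
  "affine_sphere a m F t =
     (T_matrix ** matexp (cscale t (delaunay_X a m)) ** F (of_real (Re t))) *v vector [0, 1, 0]"

end

theory Submission
  imports Defs "HOL-Complex_Analysis.Complex_Analysis"
begin

text \<open>
  Put \<open>z = t + \<beta>\<close>, \<open>p = \<wp>(z) - M\<close> and \<open>d = \<wp>'(z)\<close>, and let \<open>N(t)\<close> be the coefficient matrix of the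
  inverse frame \<open>F\<close>. Since \<open>N\<close> has trace zero, determinants of matrices whose rows solve \<open>r' = r N\<close> are
  constant, so by Cramer's rule every row solution is \<open>r(0) F(t)\<close> (\<open>row_solution_eq_frame\<close>). The
  matrix \<open>X\<close> has the eigenvalues \<open>0, k, - k\<close> with \<open>k\<^sup>2 = 3 M\<close>. If \<open>r\<close> is a row solution for which \<open>r(0)\<close>
  is a left eigenvector of \<open>X\<close> for \<open>- \<kappa>\<close>, then applying \<open>r(0)\<close> to the second column of
  \<open>exp((x + \<i> y) X) F(x)\<close> gives \<open>exp(- \<kappa> (x + \<i> y))\<close> times the second entry of \<open>r(x)\<close>. Three such row
  solutions determine the column, and \<open>T\<close> turns it into the surface.

  The row solutions are explicit. Their second entries are \<open>P(t) exp(\<kappa> t)\<close> for \<open>\<kappa> = k, - k\<close>, and \<open>Q(t)\<close>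
  for \<open>\<kappa> = 0\<close>, where \<open>P = \<sigma>(z - \<alpha>) / \<sigma>(z) exp(\<zeta>(\<alpha>) t)\<close> and
  \<open>Q = \<sigma>(z + 2 \<alpha>) / \<sigma>(z) exp(- 2 \<zeta>(\<alpha>) t)\<close>. The factor \<open>exp(\<kappa> x)\<close> cancels and \<open>exp(- \<i> \<kappa> y)\<close> remains;
  this is where \<open>cos(k y)\<close> and \<open>sin(k y)\<close> come from. That these are solutions is algebra in \<open>p\<close> and \<open>d\<close>,
  given the identities \<open>d\<^sup>2 = 4 p\<^sup>3 + 12 M p\<^sup>2 + 16\<close>, \<open>d' = 6 p\<^sup>2 + 12 M p\<close> and \<open>P' / P = (d + 4) / (2 p)\<close>.
  For \<open>Q\<close> one more relation is used: as \<open>\<wp>''(\<alpha>) = 0\<close>, the line \<open>d = 4\<close> is the tangent of the cubic at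
  the point of \<open>\<alpha>\<close>, so \<open>d - 4\<close> has a double zero at \<open>\<alpha>\<close> and a simple one at \<open>- 2 \<alpha>\<close>. Hence \<open>Q\<close> is a constant
  times \<open>(d - 4) / P\<^sup>2\<close> (\<open>\<sigma>_add_double_\<alpha>\<close>, \<open>Q_eq\<close>), a form that can be differentiated also at the
  zeros of \<open>Q\<close>.

  What remains is the theory of \<open>\<wp>\<close>, \<open>\<zeta>\<close>, \<open>\<sigma>\<close> from their series and product: absolute convergence,
  \<open>\<zeta>' = - \<wp>\<close>, \<open>\<sigma>' = \<zeta> \<sigma>\<close>, (quasi-)periodicity, and Liouville's theorem for doubly periodic functions.
  They give \<open>\<wp>(z) - \<wp>(u) = - \<sigma>(z + u) \<sigma>(z - u) / (\<sigma>(z)\<^sup>2 \<sigma>(u)\<^sup>2)\<close>, and logarithmic differentiation of this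
  identity yields the addition theorem of \<open>\<zeta>\<close>, hence \<open>P' / P\<close> and the relation for \<open>Q\<close>.
\<close>

section \<open>Lattices and lattice sums\<close>

text \<open>
  The uniform limit of holomorphic functions may be differentiated termwise along any filter, in
  particular along the filter of finite subsets that defines unordered sums.
\<close>

lemma infsum_has_field_derivative:
  fixes f f' :: "'a \<Rightarrow> complex \<Rightarrow> complex"
  assumes bound: "\<And>w z. w \<in> B \<Longrightarrow> z \<in> cball c R \<Longrightarrow> norm (f w z) \<le> M w"
    and summable: "M summable_on B"
    and deriv: "\<And>w z. w \<in> B \<Longrightarrow> z \<in> cball c R \<Longrightarrow> (f w has_field_derivative f' w z) (at z)"
    and z: "z \<in> ball c R"
  shows "((\<lambda>z. \<Sum>\<^sub>\<infinity>w\<in>B. f w z) has_field_derivative (\<Sum>\<^sub>\<infinity>w\<in>B. f' w z)) (at z)"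
    and "(\<lambda>w. f' w z) summable_on B"
proof -
  let ?F = "finite_subsets_at_top B"
  have cont: "\<forall>\<^sub>F S in ?F. continuous_on (cball c R) (\<lambda>z. \<Sum>w\<in>S. f w z) \<and>
      (\<forall>z\<in>ball c R. ((\<lambda>z. \<Sum>w\<in>S. f w z) has_field_derivative (\<Sum>w\<in>S. f' w z)) (at z))"
  proof (intro eventually_finite_subsets_at_top_weakI conjI ballI)
    fix S assume S: "S \<subseteq> B"
    have "continuous_on (cball c R) (f w)" if "w \<in> B" for w
      using deriv[OF that] by (meson DERIV_isCont continuous_at_imp_continuous_on)
    then show "continuous_on (cball c R) (\<lambda>z. \<Sum>w\<in>S. f w z)"
      using S by (intro continuous_on_sum) auto
    show "((\<lambda>z. \<Sum>w\<in>S. f w z) has_field_derivative (\<Sum>w\<in>S. f' w z)) (at z)" if "z \<in> ball c R" for z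
      using S that by (intro DERIV_sum deriv) auto
  qed
  have ulim: "uniform_limit (cball c R) (\<lambda>S z. \<Sum>w\<in>S. f w z) (\<lambda>z. \<Sum>\<^sub>\<infinity>w\<in>B. f w z) ?F"
    by (rule Weierstrass_m_test_general[OF bound summable])
  have "0 < R" using z by (metis ball_eq_empty empty_iff not_le)
  obtain g' where g': "\<And>z. z \<in> ball c R \<Longrightarrow>
      ((\<lambda>z. \<Sum>\<^sub>\<infinity>w\<in>B. f w z) has_field_derivative g' z) (at z) \<and> ((\<lambda>S. \<Sum>w\<in>S. f' w z) \<longlongrightarrow> g' z) ?F"
    by (rule has_complex_derivative_uniform_limit[OF cont ulim finite_subsets_at_top_neq_bot \<open>0 < R\<close>]) blast
  have "((\<lambda>w. f' w z) has_sum g' z) B"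
    using g'[OF z] by (simp add: has_sum_def)
  then show "((\<lambda>z. \<Sum>\<^sub>\<infinity>w\<in>B. f w z) has_field_derivative (\<Sum>\<^sub>\<infinity>w\<in>B. f' w z)) (at z)"
    and "(\<lambda>w. f' w z) summable_on B"
    using g'[OF z] by (auto simp: infsumI summable_on_def)
qed

lemma summable_on_product_real:
  fixes f :: "'a \<Rightarrow> real" and g :: "'b \<Rightarrow> real"
  assumes "f summable_on A" "g summable_on B" "\<And>x. x \<in> A \<Longrightarrow> 0 \<le> f x" "\<And>y. y \<in> B \<Longrightarrow> 0 \<le> g y"
  shows "(\<lambda>(x, y). f x * g y) summable_on A \<times> B"
proof (rule summable_on_SigmaI)
  show "((\<lambda>y. case (x, y) of (x, y) \<Rightarrow> f x * g y) has_sum f x * infsum g B) B" for x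
    using has_sum_cmult_right[OF has_sum_infsum[OF assms(2)], of "f x"] by simp
  show "(\<lambda>x. f x * infsum g B) summable_on A"
    using assms(1) by (rule summable_on_cmult_left)
qed (use assms in auto)

lemma summable_on_int_powr:
  assumes "s < - 1"
  shows "(\<lambda>p::int. (1 + \<bar>real_of_int p\<bar>) powr s) summable_on UNIV"
proof -
  have "summable (\<lambda>n. real (Suc n) powr s)"
    by (subst summable_Suc_iff, subst summable_real_powr_iff) (rule assms)
  then have nat: "(\<lambda>n::nat. (1 + real n) powr s) summable_on UNIV"
    by (intro norm_summable_imp_summable_on) (simp add: add.commute)
  have "(\<lambda>p::int. (1 + \<bar>real_of_int p\<bar>) powr s) summable_on range int"
    by (subst summable_on_reindex) (use nat in \<open>auto simp: o_def inj_def\<close>)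
  moreover have "(\<lambda>p::int. (1 + \<bar>real_of_int p\<bar>) powr s) summable_on range (\<lambda>n. - int n)"
    by (subst summable_on_reindex) (use nat in \<open>auto simp: o_def inj_def\<close>)
  moreover have "(UNIV :: int set) = range int \<union> range (\<lambda>n. - int n)"
    by (auto simp: image_iff) (metis int_cases2)
  ultimately show ?thesis
    by (metis summable_on_union)
qed

locale complex_lattice =
  fixes \<omega>\<^sub>1 \<omega>\<^sub>2 :: complex
  assumes ratio_nonreal: "\<omega>\<^sub>2 / \<omega>\<^sub>1 \<notin> \<real>"
begin

abbreviation "L \<equiv> period_lattice \<omega>\<^sub>1 \<omega>\<^sub>2"

lemma generator_nonzero: "\<omega>\<^sub>1 \<noteq> 0"
  using ratio_nonreal by auto

lemma Im_ratio_nonzero: "Im (\<omega>\<^sub>2 / \<omega>\<^sub>1) \<noteq> 0"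
  using ratio_nonreal by (simp add: complex_is_Real_iff)

lemma lattice_0 [simp]: "0 \<in> L"
  unfolding period_lattice_def by (rule CollectI, rule exI[of _ 0], rule exI[of _ 0]) simp

lemma lattice_add: "u \<in> L \<Longrightarrow> v \<in> L \<Longrightarrow> u + v \<in> L"
  unfolding period_lattice_def
proof clarify
  fix p q p' q'
  show "\<exists>r s. of_int p * \<omega>\<^sub>1 + of_int q * \<omega>\<^sub>2 + (of_int p' * \<omega>\<^sub>1 + of_int q' * \<omega>\<^sub>2) = of_int r * \<omega>\<^sub>1 + of_int s * \<omega>\<^sub>2 \<and> True"
    by (rule exI[of _ "p + p'"], rule exI[of _ "q + q'"]) (simp add: algebra_simps)
qed

lemma lattice_minus: "u \<in> L \<Longrightarrow> - u \<in> L"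
  unfolding period_lattice_def
proof clarify
  fix p q
  show "\<exists>r s. - (of_int p * \<omega>\<^sub>1 + of_int q * \<omega>\<^sub>2) = of_int r * \<omega>\<^sub>1 + of_int s * \<omega>\<^sub>2 \<and> True"
    by (rule exI[of _ "- p"], rule exI[of _ "- q"]) (simp add: algebra_simps)
qed

lemma lattice_minus_iff [simp]: "- u \<in> L \<longleftrightarrow> u \<in> L"
  using lattice_minus[of u] lattice_minus[of "- u"] by auto

lemma lattice_diff: "u \<in> L \<Longrightarrow> v \<in> L \<Longrightarrow> u - v \<in> L"
  using lattice_add[of u "- v"] by simp

lemma lattice_add_iff: "v \<in> L \<Longrightarrow> u + v \<in> L \<longleftrightarrow> u \<in> L"
  using lattice_add[of u v] lattice_diff[of "u + v" v] by auto

text \<open>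
  With \<open>\<tau> = \<omega>\<^sub>2 / \<omega>\<^sub>1\<close>, the imaginary part of \<open>p + q \<tau>\<close> controls \<open>q\<close>, and then the modulus controls \<open>p\<close>.
\<close>

lemma lattice_norm_bound:
  obtains K where "0 < K"
    "\<And>p q :: int. \<bar>real_of_int p\<bar> \<le> K * norm (of_int p * \<omega>\<^sub>1 + of_int q * \<omega>\<^sub>2)"
    "\<And>p q :: int. \<bar>real_of_int q\<bar> \<le> K * norm (of_int p * \<omega>\<^sub>1 + of_int q * \<omega>\<^sub>2)"
proof -
  define \<tau> where "\<tau> = \<omega>\<^sub>2 / \<omega>\<^sub>1"
  define C where "C = 1 / \<bar>Im \<tau>\<bar>"
  define K where "K = (1 + C + C * norm \<tau>) / norm \<omega>\<^sub>1"
  have C: "0 < C" using Im_ratio_nonzero by (simp add: C_def \<tau>_def)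
  have K: "0 < K" using C generator_nonzero unfolding K_def by (intro divide_pos_pos add_pos_nonneg) auto
  show thesis
  proof (rule that[OF K])
    fix p q :: int
    let ?v = "of_int p + of_int q * \<tau>"
    have v: "of_int p * \<omega>\<^sub>1 + of_int q * \<omega>\<^sub>2 = \<omega>\<^sub>1 * ?v"
      using generator_nonzero by (simp add: \<tau>_def field_simps)
    have "\<bar>real_of_int q\<bar> * \<bar>Im \<tau>\<bar> \<le> norm ?v"
      using abs_Im_le_cmod[of ?v] by (simp add: abs_mult)
    then have q: "\<bar>real_of_int q\<bar> \<le> C * norm ?v"
      using Im_ratio_nonzero by (simp add: C_def \<tau>_def field_simps)
    have "\<bar>real_of_int p\<bar> = norm (?v - of_int q * \<tau>)" by simp
    also have "\<dots> \<le> norm ?v + \<bar>real_of_int q\<bar> * norm \<tau>"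
      by (rule order_trans[OF norm_triangle_ineq4]) (simp add: norm_mult)
    also have "\<dots> \<le> norm ?v + (C * norm ?v) * norm \<tau>"
      by (intro add_left_mono mult_right_mono q) auto
    finally have p: "\<bar>real_of_int p\<bar> \<le> norm ?v * (1 + C * norm \<tau>)" by (simp add: algebra_simps)
    have Kv: "K * norm (of_int p * \<omega>\<^sub>1 + of_int q * \<omega>\<^sub>2) = (1 + C + C * norm \<tau>) * norm ?v"
      unfolding v norm_mult K_def using generator_nonzero by simp
    have "0 \<le> C * norm ?v" "0 \<le> C * norm \<tau> * norm ?v" using C by auto
    then show "\<bar>real_of_int p\<bar> \<le> K * norm (of_int p * \<omega>\<^sub>1 + of_int q * \<omega>\<^sub>2)"
      "\<bar>real_of_int q\<bar> \<le> K * norm (of_int p * \<omega>\<^sub>1 + of_int q * \<omega>\<^sub>2)"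
      unfolding Kv using p q by (auto simp: algebra_simps)
  qed
qed

lemma lattice_eq_image: "L = (\<lambda>(p, q). of_int p * \<omega>\<^sub>1 + of_int q * \<omega>\<^sub>2) ` UNIV"
  by (auto simp: period_lattice_def)

lemma countable_lattice: "countable L"
  unfolding lattice_eq_image by simp

lemma finite_lattice_ball: "finite {w \<in> L. norm w \<le> r}"
proof -
  obtain K where K: "0 < K"
    "\<And>p q :: int. \<bar>real_of_int p\<bar> \<le> K * norm (of_int p * \<omega>\<^sub>1 + of_int q * \<omega>\<^sub>2)"
    "\<And>p q :: int. \<bar>real_of_int q\<bar> \<le> K * norm (of_int p * \<omega>\<^sub>1 + of_int q * \<omega>\<^sub>2)"
    using lattice_norm_bound by blast
  let ?N = "\<lceil>K * r\<rceil>"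
  have "{w \<in> L. norm w \<le> r} \<subseteq> (\<lambda>(p, q). of_int p * \<omega>\<^sub>1 + of_int q * \<omega>\<^sub>2) ` ({-?N..?N} \<times> {-?N..?N})"
  proof clarify
    fix w assume "w \<in> L" and r: "norm w \<le> r"
    then obtain p q where w: "w = of_int p * \<omega>\<^sub>1 + of_int q * \<omega>\<^sub>2"
      by (auto simp: period_lattice_def)
    have "K * norm w \<le> K * r" using r K(1) by simp
    then have "\<bar>real_of_int p\<bar> \<le> K * r" "\<bar>real_of_int q\<bar> \<le> K * r"
      using K(2)[of p q] K(3)[where q=q and p=p] unfolding w by linarith+
    then have "\<bar>p\<bar> \<le> ?N" "\<bar>q\<bar> \<le> ?N" by linarith+
    then show "w \<in> (\<lambda>(p, q). of_int p * \<omega>\<^sub>1 + of_int q * \<omega>\<^sub>2) ` ({-?N..?N} \<times> {-?N..?N})"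
      unfolding w by (intro image_eqI[of _ _ "(p, q)"]) auto
  qed
  then show ?thesis by (rule finite_subset) auto
qed

text \<open>
  The cube of the maximum of \<open>\<bar>p\<bar>\<close> and \<open>\<bar>q\<bar>\<close> is split evenly between the two indices, so that the double
  sum is dominated by a product of two convergent single sums with exponent \<open>- 3 / 2\<close>.
\<close>

lemma summable_lattice_cube: "(\<lambda>w. 1 / norm w ^ 3) summable_on L - {0}"
proof -
  obtain K where K: "0 < K"
    "\<And>p q :: int. \<bar>real_of_int p\<bar> \<le> K * norm (of_int p * \<omega>\<^sub>1 + of_int q * \<omega>\<^sub>2)"
    "\<And>p q :: int. \<bar>real_of_int q\<bar> \<le> K * norm (of_int p * \<omega>\<^sub>1 + of_int q * \<omega>\<^sub>2)"
    using lattice_norm_bound by blast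
  define \<phi> where "\<phi> = (\<lambda>(p::int, q::int). of_int p * \<omega>\<^sub>1 + of_int q * \<omega>\<^sub>2)"
  define h where "h = (\<lambda>p::int. (1 + \<bar>real_of_int p\<bar>) powr (-3/2))"
  have zero: "p = 0 \<and> q = 0" if "\<phi> (p, q) = 0" for p q
    using K(2)[of p q] K(3)[where q=q and p=p] that by (auto simp: \<phi>_def)
  have inj: "inj \<phi>"
  proof (rule injI, clarify)
    fix p q p' q' assume "\<phi> (p, q) = \<phi> (p', q')"
    then have "\<phi> (p - p', q - q') = 0" by (simp add: \<phi>_def algebra_simps)
    then show "p = p' \<and> q = q'" using zero by force
  qed
  have image: "L - {0} = \<phi> ` (UNIV - {(0, 0)})"
    using zero by (auto simp: lattice_eq_image \<phi>_def)
  have prod: "(\<lambda>(p, q). h p * h q) summable_on UNIV \<times> UNIV"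
    unfolding h_def by (intro summable_on_product_real summable_on_int_powr) auto
  have "(\<lambda>v. 8 * K ^ 3 * (case v of (p, q) \<Rightarrow> h p * h q)) summable_on UNIV - {(0, 0)}"
    by (intro summable_on_cmult_right summable_on_subset_banach[OF prod]) auto
  then have "(\<lambda>v. 1 / norm (\<phi> v) ^ 3) summable_on UNIV - {(0, 0)}"
  proof (rule summable_on_comparison_test)
    fix v :: "int \<times> int" assume v: "v \<in> UNIV - {(0, 0)}"
    obtain p q where pq: "v = (p, q)" by fastforce
    define n where "n = max \<bar>real_of_int p\<bar> \<bar>real_of_int q\<bar>"
    have n1: "1 \<le> n" using v pq unfolding n_def by (auto simp: max_def)
    have n: "n \<le> K * norm (\<phi> v)" using K(2)[of p q] K(3)[where q=q and p=p] by (simp add: n_def \<phi>_def pq)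
    have pos: "0 < norm (\<phi> v)" using n n1 K(1) by (smt (verit) mult_nonneg_nonpos)
    \<comment> \<open>As \<open>1 \<le> n\<close>, both \<open>1 + \<bar>p\<bar>\<close> and \<open>1 + \<bar>q\<bar>\<close> are at most \<open>2 n\<close>.\<close>
    have hp: "(2 * n) powr (-3/2) \<le> h r" if "\<bar>real_of_int r\<bar> \<le> n" for r
      unfolding h_def using that n1 by (intro powr_mono2') auto
    have "1 / norm (\<phi> v) ^ 3 \<le> K ^ 3 / n ^ 3"
      using power_mono[OF n, of 3] n1 pos by (simp add: field_simps power_mult_distrib)
    also have "\<dots> = 8 * K ^ 3 * ((2 * n) powr (-3/2) * (2 * n) powr (-3/2))"
    proof -
      have "(2 * n) powr (-3/2) * (2 * n) powr (-3/2) = (2 * n) powr (- real 3)"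
        by (simp flip: powr_add)
      also have "\<dots> = 1 / (2 * n) ^ 3"
        by (subst powr_minus, subst powr_realpow) (use n1 in \<open>auto simp: field_simps\<close>)
      finally show ?thesis by (simp add: power_mult_distrib)
    qed
    also have "\<dots> \<le> 8 * K ^ 3 * (h p * h q)"
      using K(1) by (intro mult_left_mono mult_mono hp) (auto simp: n_def h_def)
    finally show "1 / norm (\<phi> v) ^ 3 \<le> 8 * K ^ 3 * (case v of (p, q) \<Rightarrow> h p * h q)"
      by (simp add: pq)
  qed auto
  then show ?thesis
    unfolding image by (subst summable_on_reindex) (auto simp: o_def intro: inj_on_subset[OF inj])
qed

end

lemma Ln_cubic_remainder_deriv:
  assumes "1 - u \<notin> \<real>\<^sub>\<le>\<^sub>0"
  shows "((\<lambda>u. Ln (1 - u) + u + u\<^sup>2 / 2) has_field_derivative - u\<^sup>2 / (1 - u)) (at u)"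
proof -
  have "1 - u \<noteq> 0" using assms by auto
  have "((\<lambda>u. Ln (1 - u) + u + u\<^sup>2 / 2) has_field_derivative - (inverse (1 - u)) + 1 + u) (at u)"
    using assms by (auto intro!: derivative_eq_intros)
  also have "- (inverse (1 - u)) + 1 + u = - u\<^sup>2 / (1 - u)"
    using \<open>1 - u \<noteq> 0\<close> by (simp add: divide_simps power2_eq_square) (simp add: algebra_simps)
  finally show ?thesis .
qed

text \<open>
  This makes the logarithm of a factor of the \<open>\<sigma>\<close> product summable over the lattice.
\<close>

lemma norm_Ln_cubic_remainder:
  fixes u :: complex
  assumes "norm u \<le> 1 / 2"
  shows "norm (Ln (1 - u) + u + u\<^sup>2 / 2) \<le> 2 * norm u ^ 3"
proof -
  let ?g = "\<lambda>u. Ln (1 - u) + u + u\<^sup>2 / 2"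
  have "norm (?g u - ?g 0) \<le> (2 * norm u ^ 2) * norm (u - 0)"
  proof (rule field_differentiable_bound)
    fix v :: complex assume v: "v \<in> cball 0 (norm u)"
    then have v_half: "norm v \<le> 1 / 2" using assms by simp
    then have re: "Re (1 - v) > 0" using complex_Re_le_cmod[of v] by simp
    then have "1 - v \<notin> \<real>\<^sub>\<le>\<^sub>0" by (auto simp: complex_nonpos_Reals_iff)
    then show "(?g has_field_derivative - v\<^sup>2 / (1 - v)) (at v within cball 0 (norm u))"
      by (rule has_field_derivative_at_within[OF Ln_cubic_remainder_deriv])
    have "1 / 2 \<le> norm (1 - v)" using norm_triangle_ineq2[of 1 v] v_half by simp
    then have "norm v ^ 2 / norm (1 - v) \<le> norm v ^ 2 / (1 / 2)"
      by (intro divide_left_mono) auto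
    also have "\<dots> \<le> 2 * norm u ^ 2" using v by (simp add: power_mono)
    finally show "norm (- v\<^sup>2 / (1 - v)) \<le> 2 * norm u ^ 2"
      by (simp add: norm_divide norm_power)
  qed auto
  then show ?thesis by (simp add: power3_eq_cube power2_eq_square)
qed

context complex_lattice
begin

abbreviation "wp \<equiv> weierstrass_p L"
abbreviation "\<zeta> \<equiv> weierstrass_zeta L"
abbreviation "\<sigma> \<equiv> weierstrass_sigma L"

lemma closed_lattice_subset: "closed S" if "S \<subseteq> L"
proof -
  have "\<not> x islimpt S" for x
  proof
    assume "x islimpt S"
    then have "infinite (S \<inter> ball x 1)" by (simp add: islimpt_eq_infinite_ball)
    moreover have "S \<inter> ball x 1 \<subseteq> {w \<in> L. norm w \<le> norm x + 1}"
      using that by (auto simp: dist_norm) (smt (verit) norm_triangle_ineq2 norm_minus_commute)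
    ultimately show False using finite_lattice_ball finite_subset by blast
  qed
  then show ?thesis by (simp add: closed_limpt)
qed

text \<open>
  All series below have terms of order \<open>1 / \<bar>w\<bar>\<^sup>3\<close>, uniformly on bounded sets. On a ball around \<open>z\<close> the
  terms with small \<open>w\<close> form a finite sum, and the others a uniformly convergent series.
\<close>

lemma lattice_sum_has_field_derivative:
  fixes f f' :: "complex \<Rightarrow> complex \<Rightarrow> complex"
  assumes bound: "\<And>R. 0 < R \<Longrightarrow>
      \<exists>C. \<forall>w z. 2 * R < norm w \<longrightarrow> norm z \<le> R \<longrightarrow> norm (f w z) \<le> C / norm w ^ 3"
    and deriv: "\<And>w z. w \<noteq> 0 \<Longrightarrow> z \<noteq> w \<Longrightarrow> (f w has_field_derivative f' w z) (at z)"
    and z: "z \<notin> L - {0}"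
  shows "(\<lambda>w. f w z) summable_on L - {0}"
    and "(\<lambda>w. f' w z) summable_on L - {0}"
    and "((\<lambda>z. \<Sum>\<^sub>\<infinity>w\<in>L - {0}. f w z) has_field_derivative (\<Sum>\<^sub>\<infinity>w\<in>L - {0}. f' w z)) (at z)"
proof -
  define R where "R = norm z + 1"
  have R: "0 < R" by (simp add: R_def add_nonneg_pos)
  define A B where "A = {w \<in> L - {0}. norm w \<le> 2 * R}" and "B = {w \<in> L - {0}. 2 * R < norm w}"
  have AB: "L - {0} = A \<union> B" "A \<inter> B = {}" by (auto simp: A_def B_def)
  have "finite A" unfolding A_def by (rule finite_subset[OF _ finite_lattice_ball[of "2 * R"]]) auto
  obtain C where C: "\<And>w z. 2 * R < norm w \<Longrightarrow> norm z \<le> R \<Longrightarrow> norm (f w z) \<le> C / norm w ^ 3"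
    using bound[OF R] by blast
  have "(\<lambda>w. C * (1 / norm w ^ 3)) summable_on B"
    by (intro summable_on_cmult_right summable_on_subset_banach[OF summable_lattice_cube])
      (auto simp: B_def)
  then have M: "(\<lambda>w. C / norm w ^ 3) summable_on B" by simp
  have tail_bound: "norm (f w x) \<le> C / norm w ^ 3" if "w \<in> B" "x \<in> cball 0 R" for w x
    using that by (intro C) (auto simp: B_def)
  have tail_deriv: "(f w has_field_derivative f' w x) (at x)" if "w \<in> B" "x \<in> cball 0 R" for w x
    using that R by (intro deriv) (auto simp: B_def)
  have zR: "z \<in> ball 0 R" by (simp add: R_def)
  note tail = infsum_has_field_derivative[OF tail_bound M tail_deriv zR]
  have summ: "(\<lambda>w. f w x) summable_on B" if "x \<in> cball 0 R" for x
    using Infinite_Sum.abs_summable_on_comparison_test'[OF M, of "\<lambda>w. f w x"] tail_bound that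
    by (auto intro: abs_summable_summable)
  show "(\<lambda>w. f w z) summable_on L - {0}"
    unfolding AB(1) using zR \<open>finite A\<close> by (intro summable_on_Un_disjoint summ AB(2)) auto
  show "(\<lambda>w. f' w z) summable_on L - {0}"
    unfolding AB(1) using \<open>finite A\<close> by (intro summable_on_Un_disjoint tail(2) AB(2)) auto
  have split: "(\<Sum>\<^sub>\<infinity>w\<in>L - {0}. f w x) = (\<Sum>w\<in>A. f w x) + (\<Sum>\<^sub>\<infinity>w\<in>B. f w x)"
    if "x \<in> ball 0 R" for x
    unfolding AB(1) using \<open>finite A\<close> that
    by (subst infsum_Un_disjoint) (auto intro!: summ AB(2))
  have split': "(\<Sum>\<^sub>\<infinity>w\<in>L - {0}. f' w z) = (\<Sum>w\<in>A. f' w z) + (\<Sum>\<^sub>\<infinity>w\<in>B. f' w z)"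
    unfolding AB(1) using \<open>finite A\<close> by (subst infsum_Un_disjoint) (auto intro!: tail(2) AB(2))
  have "((\<lambda>x. (\<Sum>w\<in>A. f w x) + (\<Sum>\<^sub>\<infinity>w\<in>B. f w x)) has_field_derivative
      (\<Sum>\<^sub>\<infinity>w\<in>L - {0}. f' w z)) (at z)"
    unfolding split' using z by (intro DERIV_add DERIV_sum tail(1) deriv) (auto simp: A_def)
  then show "((\<lambda>z. \<Sum>\<^sub>\<infinity>w\<in>L - {0}. f w z) has_field_derivative (\<Sum>\<^sub>\<infinity>w\<in>L - {0}. f' w z)) (at z)"
    by (rule has_field_derivative_transform_within_open[OF _ open_ball zR]) (simp add: split)
qed

lemma norm_diff_far:
  fixes w z :: complex
  assumes "2 * R < norm w" "norm z \<le> R"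
  shows "norm w / 2 \<le> norm (z - w)"
  using norm_triangle_ineq2[of w z] assms by (simp add: norm_minus_commute)

lemma wp_term_bound:
  assumes "0 < R"
  shows "\<exists>C. \<forall>w z :: complex. 2 * R < norm w \<longrightarrow> norm z \<le> R \<longrightarrow>
    norm (1 / (z - w)^2 - 1 / w^2) \<le> C / norm w ^ 3"
proof (intro exI[of _ "12 * R"] allI impI)
  fix w z :: complex assume w: "2 * R < norm w" and z: "norm z \<le> R"
  note far = norm_diff_far[OF w z]
  have w0: "0 < norm w" using w assms by linarith
  have zw: "z - w \<noteq> 0" using far w0 by auto
  have "1 / (z - w)^2 - 1 / w^2 = z * (2 * w - z) / ((z - w)^2 * w^2)"
  proof -
    have "1 / (z - w)^2 - 1 / w^2 = (w^2 - (z - w)^2) / ((z - w)^2 * w^2)"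
      using zw w0 by (simp add: diff_frac_eq)
    moreover have "w^2 - (z - w)^2 = z * (2 * w - z)"
      by (simp add: algebra_simps power2_eq_square)
    ultimately show ?thesis by simp
  qed
  moreover have "norm (z * (2 * w - z) / ((z - w)^2 * w^2)) \<le> (R * (3 * norm w)) / ((norm w / 2)^2 * norm w ^ 2)"
    unfolding norm_divide norm_mult norm_power
  proof (intro frac_le mult_mono power_mono far z)
    show "norm (2 * w - z) \<le> 3 * norm w"
      using norm_triangle_ineq4[of "2 * w" z] w z assms by (simp add: norm_mult)
  qed (use w0 assms in auto)
  moreover have "(R * (3 * norm w)) / ((norm w / 2)^2 * norm w ^ 2) = 12 * R / norm w ^ 3"
    using w0 by (simp add: field_simps power2_eq_square power3_eq_cube)
  ultimately show "norm (1 / (z - w)^2 - 1 / w^2) \<le> 12 * R / norm w ^ 3" by simp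
qed

lemma zeta_term_bound:
  assumes "0 < R"
  shows "\<exists>C. \<forall>w z :: complex. 2 * R < norm w \<longrightarrow> norm z \<le> R \<longrightarrow>
    norm (1 / (z - w) + 1 / w + z / w^2) \<le> C / norm w ^ 3"
proof (intro exI[of _ "2 * R\<^sup>2"] allI impI)
  fix w z :: complex assume w: "2 * R < norm w" and z: "norm z \<le> R"
  note far = norm_diff_far[OF w z]
  have w0: "0 < norm w" using w assms by linarith
  have zw: "z - w \<noteq> 0" using far w0 by auto
  have "1 / (z - w) + 1 / w + z / w^2 = z^2 / ((z - w) * w^2)"
    using zw w0 by (simp add: field_simps power2_eq_square)
  moreover have "norm (z^2 / ((z - w) * w^2)) \<le> R^2 / ((norm w / 2) * norm w ^ 2)"
    unfolding norm_divide norm_mult norm_power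
    by (intro frac_le mult_mono power_mono far z) (use w0 assms in auto)
  moreover have "R^2 / ((norm w / 2) * norm w ^ 2) = 2 * R\<^sup>2 / norm w ^ 3"
    using w0 by (simp add: field_simps power2_eq_square power3_eq_cube)
  ultimately show "norm (1 / (z - w) + 1 / w + z / w^2) \<le> 2 * R\<^sup>2 / norm w ^ 3" by simp
qed

lemma wp_term_deriv:
  fixes w z :: complex
  assumes "z \<noteq> w"
  shows "((\<lambda>z. 1 / (z - w)^2 - 1 / w^2) has_field_derivative - 2 / (z - w)^3) (at z)"
proof -
  define d where "d = z - w"
  have "d \<noteq> 0" using assms by (simp add: d_def)
  have "((\<lambda>z. 1 / (z - w)^2 - 1 / w^2) has_field_derivative - (2 * d) / (d\<^sup>2 * d\<^sup>2)) (at z)"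
    using assms unfolding d_def by (auto intro!: derivative_eq_intros)
  also have "- (2 * d) / (d\<^sup>2 * d\<^sup>2) = - 2 / (z - w)^3"
    unfolding d_def[symmetric] using \<open>d \<noteq> 0\<close> by (simp add: field_simps power2_eq_square power3_eq_cube)
  finally show ?thesis .
qed

lemma zeta_term_deriv:
  fixes w z :: complex
  assumes "w \<noteq> 0" "z \<noteq> w"
  shows "((\<lambda>z. 1 / (z - w) + 1 / w + z / w^2) has_field_derivative - (1 / (z - w)^2 - 1 / w^2)) (at z)"
  using assms by (auto intro!: derivative_eq_intros simp: field_simps power2_eq_square)

lemma wp_sum:
  assumes "z \<notin> L - {0}"
  shows "(\<lambda>w. 1 / (z - w)^2 - 1 / w^2) summable_on L - {0}"
    and "(\<lambda>w. - 2 / (z - w)^3) summable_on L - {0}"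
    and "((\<lambda>z. \<Sum>\<^sub>\<infinity>w\<in>L - {0}. 1 / (z - w)^2 - 1 / w^2) has_field_derivative
      (\<Sum>\<^sub>\<infinity>w\<in>L - {0}. - 2 / (z - w)^3)) (at z)"
  by (rule lattice_sum_has_field_derivative[OF wp_term_bound wp_term_deriv assms]; assumption)+

lemma zeta_sum:
  assumes "z \<notin> L - {0}"
  shows "(\<lambda>w. 1 / (z - w) + 1 / w + z / w^2) summable_on L - {0}"
    and "((\<lambda>z. \<Sum>\<^sub>\<infinity>w\<in>L - {0}. 1 / (z - w) + 1 / w + z / w^2) has_field_derivative
      - (\<Sum>\<^sub>\<infinity>w\<in>L - {0}. 1 / (z - w)^2 - 1 / w^2)) (at z)"
  unfolding infsum_uminus[symmetric]
  by (rule lattice_sum_has_field_derivative[OF zeta_term_bound zeta_term_deriv assms]; assumption)+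

lemma wp_has_field_derivative_sum:
  assumes "z \<notin> L"
  shows "(wp has_field_derivative (\<Sum>\<^sub>\<infinity>w\<in>L. - 2 / (z - w)^3)) (at z)"
proof -
  have z0: "z \<noteq> 0" and z: "z \<notin> L - {0}" using assms by (auto intro: lattice_0)
  have "(\<Sum>\<^sub>\<infinity>w\<in>insert 0 (L - {0}). - 2 / (z - w)^3)
      = - 2 / z^3 + (\<Sum>\<^sub>\<infinity>w\<in>L - {0}. - 2 / (z - w)^3)"
    by (subst infsum_insert) (use wp_sum(2)[OF z] in auto)
  then have "(\<Sum>\<^sub>\<infinity>w\<in>L. - 2 / (z - w)^3) = - 2 / z^3 + (\<Sum>\<^sub>\<infinity>w\<in>L - {0}. - 2 / (z - w)^3)"
    by (simp add: insert_absorb)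
  note sum = this
  have "((\<lambda>z. 1 / z^2) has_field_derivative - 2 / z^3) (at z)"
    using wp_term_deriv[of z 0] z0 by simp
  from DERIV_add[OF this wp_sum(3)[OF z]] show ?thesis
    unfolding weierstrass_p_def[abs_def] sum .
qed

lemma zeta_deriv:
  assumes "z \<notin> L"
  shows "(\<zeta> has_field_derivative - wp z) (at z)"
proof -
  have z0: "z \<noteq> 0" and z: "z \<notin> L - {0}" using assms by (auto intro: lattice_0)
  have "((\<lambda>z. 1 / z) has_field_derivative - (1 / z^2)) (at z)"
    using z0 by (auto intro!: derivative_eq_intros simp: power2_eq_square)
  from DERIV_add[OF this zeta_sum(2)[OF z]] show ?thesis
    unfolding weierstrass_p_def weierstrass_zeta_def[abs_def] by simp
qed

end

definition weierstrass_E :: "complex \<Rightarrow> complex \<Rightarrow> complex" where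
  "weierstrass_E w z = weierstrass_factor 2 (z / w)"

lemma weierstrass_E_eq: "weierstrass_E w z = (1 - z / w) * exp (z / w + (z / w)^2 / 2)"
  by (simp add: weierstrass_E_def weierstrass_factor_def numeral_2_eq_2)

section \<open>The product for \<open>\<sigma>\<close>\<close>

lemma zeta_term_eq:
  fixes w z :: complex
  assumes "w \<noteq> 0" "z \<noteq> w"
  shows "1 / (z - w) + 1 / w + z / w^2 = - ((z / w)^2 / (1 - z / w)) / w"
proof -
  define d where "d = z - w"
  have z: "z = d + w" and d: "d \<noteq> 0" using assms by (auto simp: d_def)
  have "1 - z / w = - (d / w)" using assms(1) by (simp add: z field_simps)
  moreover have "1 / d + 1 / w + (d + w) / w^2 = ((d + w) / w)^2 / (d / w) / w"
    using assms(1) d by (simp add: field_simps power2_eq_square)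
  ultimately show ?thesis by (simp add: z)
qed

lemma weierstrass_E_deriv:
  assumes "w \<noteq> 0"
  shows "(weierstrass_E w has_field_derivative
    - ((z / w)^2 / w) * exp (z / w + (z / w)^2 / 2)) (at z)"
proof -
  let ?e = "\<lambda>u::complex. (1 - u) * exp (u + u^2 / 2)"
  have "(?e has_field_derivative - (u^2) * exp (u + u^2 / 2)) (at u)" for u
    by (auto intro!: derivative_eq_intros simp: algebra_simps power2_eq_square)
  moreover have "((\<lambda>z. z / w) has_field_derivative 1 / w) (at z)"
    using assms by (auto intro!: derivative_eq_intros)
  ultimately have "((\<lambda>z. ?e (z / w)) has_field_derivative
      - ((z / w)^2) * exp (z / w + (z / w)^2 / 2) * (1 / w)) (at z)"
    by (rule DERIV_chain2)
  then show ?thesis by (simp add: weierstrass_E_eq[abs_def] mult_ac)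
qed

lemma weierstrass_E_log_deriv:
  assumes "w \<noteq> 0" "z \<noteq> w"
  shows "(weierstrass_E w has_field_derivative
    weierstrass_E w z * (1 / (z - w) + 1 / w + z / w^2)) (at z)"
proof -
  have "1 - z / w \<noteq> 0" using assms by simp
  then have "(1 - z / w) * (1 / (z - w) + 1 / w + z / w^2) = - ((z / w)^2 / w)"
    unfolding zeta_term_eq[OF assms] by simp
  then have "weierstrass_E w z * (1 / (z - w) + 1 / w + z / w^2)
      = - ((z / w)^2 / w) * exp (z / w + (z / w)^2 / 2)"
    unfolding weierstrass_E_eq by (metis mult.commute mult.left_commute)
  then show ?thesis
    using weierstrass_E_deriv[OF assms(1), of z] by simp
qed

lemma weierstrass_E_nonzero: "w \<noteq> 0 \<Longrightarrow> z \<noteq> w \<Longrightarrow> weierstrass_E w z \<noteq> 0"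
  by (simp add: weierstrass_E_eq)

context complex_lattice
begin

text \<open>
  This is \<open>\<sigma>(z) / z\<close>; being nonzero at \<open>0\<close>, it is the right factor for local arguments there.
\<close>

definition \<sigma>\<^sub>0 :: "complex \<Rightarrow> complex" where
  "\<sigma>\<^sub>0 z = Lim (finite_subsets_at_top (L - {0})) (\<lambda>S. \<Prod>w\<in>S. weierstrass_E w z)"

lemma \<sigma>_eq: "\<sigma> z = z * \<sigma>\<^sub>0 z"
  by (simp add: weierstrass_sigma_def \<sigma>\<^sub>0_def weierstrass_E_eq)

text \<open>
  On a ball, the factors with large \<open>w\<close> have a logarithm, so the unordered product becomes a finite
  product times the exponential of an unordered sum. The derivative of the exponent is the tail of the
  series of \<open>\<zeta>\<close>.
\<close>

lemma \<sigma>\<^sub>0_local: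
  assumes R: "0 < R"
  defines "A \<equiv> {w \<in> L - {0}. norm w \<le> 2 * R}" and "B \<equiv> {w \<in> L - {0}. 2 * R < norm w}"
  obtains g where
    "\<forall>z \<in> ball 0 R. ((\<lambda>S. \<Prod>w\<in>S. weierstrass_E w z) \<longlongrightarrow>
        (\<Prod>w\<in>A. weierstrass_E w z) * exp (g z)) (finite_subsets_at_top (L - {0}))"
    "\<forall>z \<in> ball 0 R. (g has_field_derivative (\<Sum>\<^sub>\<infinity>w\<in>B. 1 / (z - w) + 1 / w + z / w^2)) (at z)"
    "\<forall>z \<in> ball 0 R. (\<lambda>w. 1 / (z - w) + 1 / w + z / w^2) summable_on B"
proof -
  define l where "l w z = Ln (1 - z / w) + z / w + (z / w)^2 / 2" for w z :: complex
  have finA: "finite A" unfolding A_def by (rule finite_subset[OF _ finite_lattice_ball[of "2 * R"]]) auto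
  have small: "norm (z / w) \<le> 1 / 2" if "w \<in> B" "z \<in> cball 0 R" for w z
    using that R by (auto simp: B_def norm_divide field_simps)
  have ne: "w \<noteq> 0" "z \<noteq> w" if "w \<in> B" "z \<in> cball 0 R" for w z
    using that R by (auto simp: B_def)
  have bound: "norm (l w z) \<le> 2 * R ^ 3 * (1 / norm w ^ 3)" if "w \<in> B" "z \<in> cball 0 R" for w z
  proof -
    have "norm (l w z) \<le> 2 * norm (z / w) ^ 3"
      unfolding l_def by (rule norm_Ln_cubic_remainder[OF small[OF that]])
    also have "\<dots> \<le> 2 * (R / norm w) ^ 3"
      using that by (intro mult_left_mono power_mono) (auto simp: norm_divide divide_right_mono)
    finally show ?thesis by (simp add: power_divide)
  qed
  have summ: "(\<lambda>w. 2 * R ^ 3 * (1 / norm w ^ 3)) summable_on B"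
    by (intro summable_on_cmult_right summable_on_subset_banach[OF summable_lattice_cube])
      (auto simp: B_def)
  have deriv: "(l w has_field_derivative 1 / (z - w) + 1 / w + z / w^2) (at z)"
    if "w \<in> B" "z \<in> cball 0 R" for w z
  proof -
    have "Re (1 - z / w) > 0"
      using small[OF that] complex_Re_le_cmod[of "z / w"] by simp
    then have nonpos: "1 - z / w \<notin> \<real>\<^sub>\<le>\<^sub>0" by (auto simp: complex_nonpos_Reals_iff)
    have "((\<lambda>z. z / w) has_field_derivative 1 / w) (at z)"
      using ne[OF that] by (auto intro!: derivative_eq_intros)
    from DERIV_chain2[OF Ln_cubic_remainder_deriv[OF nonpos] this]
    have "(l w has_field_derivative - (z / w)\<^sup>2 / (1 - z / w) * (1 / w)) (at z)"
      unfolding l_def[abs_def] .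
    then show ?thesis
      unfolding zeta_term_eq[OF ne[OF that]] by simp
  qed
  note tail = infsum_has_field_derivative[OF bound summ deriv]
  show thesis
  proof (rule that, intro ballI)
    show "\<forall>z \<in> ball 0 R. ((\<lambda>z. \<Sum>\<^sub>\<infinity>w\<in>B. l w z) has_field_derivative
        (\<Sum>\<^sub>\<infinity>w\<in>B. 1 / (z - w) + 1 / w + z / w^2)) (at z)"
      "\<forall>z \<in> ball 0 R. (\<lambda>w. 1 / (z - w) + 1 / w + z / w^2) summable_on B"
      using tail by blast+
    fix z :: complex assume "z \<in> ball 0 R"
    then have z: "z \<in> cball 0 R" by simp
    have "(\<lambda>w. l w z) summable_on B"
      using Infinite_Sum.abs_summable_on_comparison_test'[OF summ, of "\<lambda>w. l w z"] bound z
      by (auto intro: abs_summable_summable)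
    then have "((\<lambda>w. l w z) has_sum (\<Sum>\<^sub>\<infinity>w\<in>B. l w z)) B" by (rule has_sum_infsum)
    \<comment> \<open>Padding with zeros on \<open>A\<close> lets the sum and the product run over the same finite subsets of \<open>L - {0}\<close>.\<close>
    then have "((\<lambda>w. if w \<in> A then 0 else l w z) has_sum (\<Sum>\<^sub>\<infinity>w\<in>B. l w z)) (L - {0})"
      by (subst has_sum_cong_neutral[where T = B and g = "\<lambda>w. l w z"]) (auto simp: A_def B_def)
    then have "((\<lambda>S. \<Sum>w\<in>S. if w \<in> A then 0 else l w z) \<longlongrightarrow> (\<Sum>\<^sub>\<infinity>w\<in>B. l w z))
        (finite_subsets_at_top (L - {0}))"
      by (simp add: has_sum_def)
    then have lim: "((\<lambda>S. (\<Prod>w\<in>A. weierstrass_E w z) * exp (\<Sum>w\<in>S. if w \<in> A then 0 else l w z)) \<longlongrightarrow>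
        (\<Prod>w\<in>A. weierstrass_E w z) * exp (\<Sum>\<^sub>\<infinity>w\<in>B. l w z)) (finite_subsets_at_top (L - {0}))"
      by (intro tendsto_intros)
    show "((\<lambda>S. \<Prod>w\<in>S. weierstrass_E w z) \<longlongrightarrow>
        (\<Prod>w\<in>A. weierstrass_E w z) * exp (\<Sum>\<^sub>\<infinity>w\<in>B. l w z)) (finite_subsets_at_top (L - {0}))"
    proof (rule Lim_transform_eventually[OF lim])
      have "\<forall>\<^sub>F S in finite_subsets_at_top (L - {0}). finite S \<and> A \<subseteq> S \<and> S \<subseteq> L - {0}"
        unfolding eventually_finite_subsets_at_top
        by (rule exI[of _ A]) (use finA in \<open>auto simp: A_def\<close>)
      then show "\<forall>\<^sub>F S in finite_subsets_at_top (L - {0}).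
          (\<Prod>w\<in>A. weierstrass_E w z) * exp (\<Sum>w\<in>S. if w \<in> A then 0 else l w z) = (\<Prod>w\<in>S. weierstrass_E w z)"
      proof (rule eventually_mono, elim conjE)
        fix S assume S: "finite S" "A \<subseteq> S" "S \<subseteq> L - {0}"
        have "(\<Sum>w\<in>S. if w \<in> A then 0 else l w z) = (\<Sum>w\<in>S - A. l w z)"
          using S by (intro sum.mono_neutral_cong_right) auto
        moreover have "exp (l w z) = weierstrass_E w z" if "w \<in> S - A" for w
        proof -
          have "w \<in> B" using that S by (auto simp: A_def B_def)
          then have "1 - z / w \<noteq> 0" using ne[OF _ z] by simp
          then show ?thesis by (simp add: l_def weierstrass_E_eq exp_add mult_ac)
        qed
        ultimately have "exp (\<Sum>w\<in>S. if w \<in> A then 0 else l w z) = (\<Prod>w\<in>S - A. weierstrass_E w z)"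
          using S by (simp add: exp_sum)
        then show "(\<Prod>w\<in>A. weierstrass_E w z) * exp (\<Sum>w\<in>S. if w \<in> A then 0 else l w z) = (\<Prod>w\<in>S. weierstrass_E w z)"
          using prod.subset_diff[OF S(2,1), of "\<lambda>w. weierstrass_E w z"] by (simp add: mult.commute)
      qed
    qed
  qed
qed

lemma \<sigma>\<^sub>0_tendsto:
  "((\<lambda>S. \<Prod>w\<in>S. weierstrass_E w z) \<longlongrightarrow> \<sigma>\<^sub>0 z) (finite_subsets_at_top (L - {0}))"
proof -
  have R: "0 < norm z + 1" and z: "z \<in> ball 0 (norm z + 1)" by (auto simp: add_nonneg_pos)
  have "\<exists>l. ((\<lambda>S. \<Prod>w\<in>S. weierstrass_E w z) \<longlongrightarrow> l) (finite_subsets_at_top (L - {0}))"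
  proof (rule \<sigma>\<^sub>0_local[OF R], goal_cases)
    case (1 g)
    from bspec[OF 1(1) z] show ?case by (rule exI)
  qed
  then show ?thesis
    unfolding \<sigma>\<^sub>0_def by (metis tendsto_Lim finite_subsets_at_top_neq_bot)
qed

lemma \<sigma>\<^sub>0_factor:
  obtains A g U where "finite A" "A \<subseteq> L - {0}" "z \<in> U" "open U"
    "\<forall>x\<in>U. \<sigma>\<^sub>0 x = (\<Prod>w\<in>A. weierstrass_E w x) * exp (g x)"
    "(g has_field_derivative (\<Sum>\<^sub>\<infinity>w\<in>L - {0} - A. 1 / (z - w) + 1 / w + z / w^2)) (at z)"
    "(\<lambda>w. 1 / (z - w) + 1 / w + z / w^2) summable_on L - {0} - A"
proof -
  define R where "R = norm z + 1"
  have R: "0 < R" and z: "z \<in> ball 0 R" by (auto simp: R_def add_nonneg_pos)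
  define A where "A = {w \<in> L - {0}. norm w \<le> 2 * R}"
  have finA: "finite A" unfolding A_def by (rule finite_subset[OF _ finite_lattice_ball[of "2 * R"]]) auto
  have B: "{w \<in> L - {0}. 2 * R < norm w} = L - {0} - A" by (auto simp: A_def)
  obtain g where g: 
    "\<forall>z \<in> ball 0 R. ((\<lambda>S. \<Prod>w\<in>S. weierstrass_E w z) \<longlongrightarrow>
        (\<Prod>w\<in>A. weierstrass_E w z) * exp (g z)) (finite_subsets_at_top (L - {0}))"
    "\<forall>z \<in> ball 0 R. (g has_field_derivative (\<Sum>\<^sub>\<infinity>w\<in>L - {0} - A. 1 / (z - w) + 1 / w + z / w^2)) (at z)"
    "\<forall>z \<in> ball 0 R. (\<lambda>w. 1 / (z - w) + 1 / w + z / w^2) summable_on L - {0} - A"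
    using \<sigma>\<^sub>0_local[OF R, folded A_def, unfolded B] by (auto simp only:)
  have "\<sigma>\<^sub>0 x = (\<Prod>w\<in>A. weierstrass_E w x) * exp (g x)" if "x \<in> ball 0 R" for x
    by (rule tendsto_unique[OF finite_subsets_at_top_neq_bot \<sigma>\<^sub>0_tendsto bspec[OF g(1) that]])
  then show thesis
    by (intro that[OF finA _ z open_ball _ bspec[OF g(2) z] bspec[OF g(3) z]]) (auto simp: A_def)
qed

lemma \<sigma>\<^sub>0_differentiable: "\<sigma>\<^sub>0 field_differentiable (at z)"
proof -
  obtain A g U where *: "finite A" "A \<subseteq> L - {0}" "z \<in> U" "open U"
    "\<forall>x\<in>U. \<sigma>\<^sub>0 x = (\<Prod>w\<in>A. weierstrass_E w x) * exp (g x)"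
    "(g has_field_derivative (\<Sum>\<^sub>\<infinity>w\<in>L - {0} - A. 1 / (z - w) + 1 / w + z / w^2)) (at z)"
    by (rule \<sigma>\<^sub>0_factor[of z]) (rule that)
  have "(\<lambda>x. \<Prod>w\<in>A. weierstrass_E w x) field_differentiable (at z)"
    using *(1,2)
  proof induction
    case (insert w A)
    then have "weierstrass_E w field_differentiable (at z)"
      using weierstrass_E_deriv[of w z] by (auto simp: field_differentiable_def)
    with insert show ?case by (auto intro!: derivative_intros)
  qed auto
  then obtain d where "((\<lambda>x. \<Prod>w\<in>A. weierstrass_E w x) has_field_derivative d) (at z)"
    by (auto simp: field_differentiable_def)
  from DERIV_mult[OF this DERIV_fun_exp[OF *(6)]] show ?thesis
    unfolding field_differentiable_def
    using has_field_derivative_transform_within_open[OF _ *(4,3), of _ _ \<sigma>\<^sub>0] *(5) by auto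
qed

lemma prod_weierstrass_E_deriv:
  assumes "finite A" "0 \<notin> A" "z \<notin> A"
  shows "((\<lambda>x. \<Prod>w\<in>A. weierstrass_E w x) has_field_derivative
    (\<Prod>w\<in>A. weierstrass_E w z) * (\<Sum>w\<in>A. 1 / (z - w) + 1 / w + z / w^2)) (at z)"
  using assms
proof induction
  case (insert w A)
  then have "w \<noteq> 0" "z \<noteq> w" by auto
  from DERIV_mult[OF weierstrass_E_log_deriv[OF this] insert.IH] insert show ?case
    by (simp add: algebra_simps)
qed auto

lemma
  assumes z: "z \<notin> L - {0}"
  shows \<sigma>\<^sub>0_nonzero: "\<sigma>\<^sub>0 z \<noteq> 0"
    and \<sigma>\<^sub>0_deriv: "(\<sigma>\<^sub>0 has_field_derivative
      \<sigma>\<^sub>0 z * (\<Sum>\<^sub>\<infinity>w\<in>L - {0}. 1 / (z - w) + 1 / w + z / w^2)) (at z)"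
proof -
  obtain A g U where *: "finite A" "A \<subseteq> L - {0}" "z \<in> U" "open U"
    "\<forall>x\<in>U. \<sigma>\<^sub>0 x = (\<Prod>w\<in>A. weierstrass_E w x) * exp (g x)"
    "(g has_field_derivative (\<Sum>\<^sub>\<infinity>w\<in>L - {0} - A. 1 / (z - w) + 1 / w + z / w^2)) (at z)"
    "(\<lambda>w. 1 / (z - w) + 1 / w + z / w^2) summable_on L - {0} - A"
    by (rule \<sigma>\<^sub>0_factor[of z]) (rule that)
  have A: "0 \<notin> A" "z \<notin> A" using *(2) z by auto
  show "\<sigma>\<^sub>0 z \<noteq> 0"
    unfolding bspec[OF *(5,3)] using *(1) A weierstrass_E_nonzero[of _ z] by auto metis
  let ?t = "\<lambda>w. 1 / (z - w) + 1 / w + z / w^2"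
  have "(\<Sum>\<^sub>\<infinity>w\<in>A \<union> (L - {0} - A). ?t w) = (\<Sum>w\<in>A. ?t w) + (\<Sum>\<^sub>\<infinity>w\<in>L - {0} - A. ?t w)"
    by (subst infsum_Un_disjoint) (use *(1,7) in auto)
  moreover have "A \<union> (L - {0} - A) = L - {0}" using *(2) by auto
  ultimately have split: "(\<Sum>\<^sub>\<infinity>w\<in>L - {0}. ?t w) = (\<Sum>w\<in>A. ?t w) + (\<Sum>\<^sub>\<infinity>w\<in>L - {0} - A. ?t w)" by simp
  have "((\<lambda>x. (\<Prod>w\<in>A. weierstrass_E w x) * exp (g x)) has_field_derivative
      \<sigma>\<^sub>0 z * (\<Sum>\<^sub>\<infinity>w\<in>L - {0}. ?t w)) (at z)"
    unfolding split bspec[OF *(5,3)]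
    by (rule DERIV_cong[OF DERIV_mult[OF prod_weierstrass_E_deriv[OF *(1) A] DERIV_fun_exp[OF *(6)]]])
      (simp add: algebra_simps)
  then show "(\<sigma>\<^sub>0 has_field_derivative \<sigma>\<^sub>0 z * (\<Sum>\<^sub>\<infinity>w\<in>L - {0}. ?t w)) (at z)"
    by (rule has_field_derivative_transform_within_open[OF _ *(4,3)]) (simp add: *(5))
qed

lemma \<sigma>_deriv:
  assumes "z \<notin> L"
  shows "(\<sigma> has_field_derivative \<zeta> z * \<sigma> z) (at z)"
proof -
  have z: "z \<noteq> 0" "z \<notin> L - {0}" using assms by (auto intro: lattice_0)
  have "((\<lambda>z. z * \<sigma>\<^sub>0 z) has_field_derivative \<zeta> z * (z * \<sigma>\<^sub>0 z)) (at z)"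
    by (rule DERIV_cong[OF DERIV_mult[OF DERIV_ident \<sigma>\<^sub>0_deriv[OF z(2)]]])
      (use z(1) in \<open>simp add: weierstrass_zeta_def field_simps\<close>)
  then show ?thesis by (simp add: \<sigma>_eq[abs_def])
qed

lemma \<sigma>_nonzero: "z \<notin> L \<Longrightarrow> \<sigma> z \<noteq> 0"
  using \<sigma>\<^sub>0_nonzero[of z] lattice_0 by (auto simp: \<sigma>_eq)

lemma \<sigma>_0 [simp]: "\<sigma> 0 = 0"
  by (simp add: \<sigma>_eq)

lemma \<sigma>\<^sub>0_0: "\<sigma>\<^sub>0 0 = 1"
proof -
  have "(\<lambda>S. \<Prod>w\<in>S. weierstrass_E w 0) = (\<lambda>_. 1)"
    by (simp add: fun_eq_iff weierstrass_E_eq)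
  then show ?thesis
    unfolding \<sigma>\<^sub>0_def by (simp add: tendsto_Lim)
qed

lemma bij_minus_lattice: "bij_betw uminus (L - {0}) (L - {0})"
  by (rule bij_betwI[where g = uminus]) auto

text \<open>
  Negation permutes the lattice, hence also its finite subsets along the filter.
\<close>

lemma \<sigma>\<^sub>0_minus: "\<sigma>\<^sub>0 (- z) = \<sigma>\<^sub>0 z"
proof -
  let ?F = "finite_subsets_at_top (L - {0})"
  have img: "uminus ` (L - {0}) = L - {0}" using bij_minus_lattice by (simp add: bij_betw_def)
  have "filtermap ((`) uminus) ?F = finite_subsets_at_top (uminus ` (L - {0}))"
    by (rule filtermap_image_finite_subsets_at_top) auto
  then have "filterlim ((`) uminus) ?F ?F" by (simp add: filterlim_def img)
  from filterlim_compose[OF \<sigma>\<^sub>0_tendsto this]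
  have "((\<lambda>S. \<Prod>w\<in>uminus ` S. weierstrass_E w z) \<longlongrightarrow> \<sigma>\<^sub>0 z) ?F" .
  moreover have "(\<Prod>w\<in>uminus ` S. weierstrass_E w z) = (\<Prod>w\<in>S. weierstrass_E w (- z))" for S
    by (subst prod.reindex) (auto simp: weierstrass_E_eq)
  ultimately show ?thesis
    using tendsto_unique[OF finite_subsets_at_top_neq_bot \<sigma>\<^sub>0_tendsto] by force
qed

lemma \<sigma>_minus: "\<sigma> (- z) = - \<sigma> z"
  by (simp add: \<sigma>_eq \<sigma>\<^sub>0_minus)

lemma wp_minus: "wp (- z) = wp z"
proof -
  have "(\<Sum>\<^sub>\<infinity>w\<in>L - {0}. 1 / (- z - w)^2 - 1 / w^2) = (\<Sum>\<^sub>\<infinity>w\<in>L - {0}. 1 / (- z - (- w))^2 - 1 / (- w)^2)"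
    by (rule infsum_reindex_bij_betw[OF bij_minus_lattice, symmetric])
  also have "\<dots> = (\<Sum>\<^sub>\<infinity>w\<in>L - {0}. 1 / (z - w)^2 - 1 / w^2)"
    by (intro infsum_cong) (simp add: power2_commute)
  finally show ?thesis by (simp add: weierstrass_p_def)
qed

lemma \<zeta>_minus: "\<zeta> (- z) = - \<zeta> z"
proof -
  have "(\<Sum>\<^sub>\<infinity>w\<in>L - {0}. 1 / (- z - w) + 1 / w + - z / w^2)
      = (\<Sum>\<^sub>\<infinity>w\<in>L - {0}. 1 / (- z - (- w)) + 1 / (- w) + - z / (- w)^2)"
    by (rule infsum_reindex_bij_betw[OF bij_minus_lattice, symmetric])
  also have "\<dots> = (\<Sum>\<^sub>\<infinity>w\<in>L - {0}. - (1 / (z - w) + 1 / w + z / w^2))"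
  proof (intro infsum_cong)
    fix w :: complex
    have "1 / (w - z) = - (1 / (z - w))" by (metis minus_diff_eq minus_divide_right)
    then show "1 / (- z - (- w)) + 1 / (- w) + - z / (- w)^2 = - (1 / (z - w) + 1 / w + z / w^2)" by simp
  qed
  also have "\<dots> = - (\<Sum>\<^sub>\<infinity>w\<in>L - {0}. 1 / (z - w) + 1 / w + z / w^2)"
    by (rule infsum_uminus)
  finally have sum: "(\<Sum>\<^sub>\<infinity>w\<in>L - {0}. 1 / (- z - w) + 1 / w + - z / w^2)
      = - (\<Sum>\<^sub>\<infinity>w\<in>L - {0}. 1 / (z - w) + 1 / w + z / w^2)" .
  show ?thesis unfolding weierstrass_zeta_def sum by simp
qed

end

context complex_lattice
begin

lemma open_complement_lattice: "open (- S)" if "S \<subseteq> L"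
  using closed_lattice_subset[OF that] by (simp add: open_Compl)

section \<open>Periodicity\<close>

lemma connected_complement_lattice: "connected (- L)"
  unfolding Compl_eq_Diff_UNIV
  by (rule connected_open_diff_countable) (auto simp: countable_lattice)

lemma zero_derivative_imp_constant:
  assumes "\<And>x. x \<notin> L \<Longrightarrow> (f has_field_derivative 0) (at x)"
  obtains c where "\<And>x. x \<notin> L \<Longrightarrow> f x = c"
proof -
  have "f constant_on - L"
    using assms by (intro has_field_derivative_0_imp_constant_on connected_complement_lattice
        open_complement_lattice) auto
  then show thesis using that by (auto simp: constant_on_def)
qed

lemma wp_differentiable: "z \<notin> L \<Longrightarrow> wp field_differentiable (at z)"
  using wp_has_field_derivative_sum field_differentiable_def by blast

lemma wp_deriv: "z \<notin> L \<Longrightarrow> (wp has_field_derivative deriv wp z) (at z)"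
  using wp_differentiable field_differentiable_derivI by blast

lemma wp_holomorphic: "wp holomorphic_on - L"
  using wp_differentiable holomorphic_on_open open_complement_lattice[OF order_refl]
  by (metis ComplD field_differentiable_at_within holomorphic_on_def)

text \<open>
  The series of the derivative runs over the whole lattice, so a translation only reindexes it.
\<close>

lemma deriv_wp_periodic:
  assumes v: "v \<in> L" and z: "z \<notin> L"
  shows "deriv wp (z + v) = deriv wp z"
proof -
  have bij: "bij_betw (\<lambda>w. w + v) L L"
    by (rule bij_betwI[where g = "\<lambda>w. w - v"]) (use v lattice_add lattice_diff in auto)
  have "(\<Sum>\<^sub>\<infinity>w\<in>L. - 2 / (z + v - w)^3) = (\<Sum>\<^sub>\<infinity>w\<in>L. - 2 / (z + v - (w + v))^3)"
    by (rule infsum_reindex_bij_betw[OF bij, symmetric])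
  then show ?thesis
    using wp_has_field_derivative_sum[of z] wp_has_field_derivative_sum[of "z + v"] v z
    by (simp add: DERIV_imp_deriv lattice_add_iff)
qed

text \<open>
  The difference \<open>\<wp>(z + v) - \<wp>(z)\<close> is a constant \<open>c\<close>. Evaluating it also at \<open>- z - v\<close> and using that \<open>\<wp>\<close>
  is even gives \<open>c = - c\<close>.
\<close>

lemma wp_periodic:
  assumes v: "v \<in> L" and z: "z \<notin> L"
  shows "wp (z + v) = wp z"
proof -
  have "((\<lambda>z. wp (z + v) - wp z) has_field_derivative 0) (at x)" if "x \<notin> L" for x
  proof -
    have "x + v \<notin> L" "x \<notin> L" using that v by (auto simp: lattice_add_iff)
    from DERIV_diff[OF wp_deriv[OF this(1), unfolded DERIV_shift] wp_deriv[OF this(2)]] show ?thesis using deriv_wp_periodic[OF v] that by simp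
  qed
  from zero_derivative_imp_constant[OF this] obtain c where c: "\<And>x. x \<notin> L \<Longrightarrow> wp (x + v) - wp x = c"
    by auto
  have "- (z + v) \<notin> L" using v z by (simp add: lattice_add_iff del: minus_add_distrib)
  then have "wp (- (z + v) + v) - wp (- (z + v)) = c" by (intro c) simp
  moreover have "- (z + v) + v = - z" by simp
  ultimately have "wp z - wp (z + v) = c" by (metis wp_minus)
  moreover have "wp (z + v) - wp z = c" using c z by simp
  ultimately have "2 * (wp (z + v) - wp z) = 0" by (simp add: algebra_simps)
  then show ?thesis by simp
qed

lemma \<zeta>_quasiperiodic:
  assumes v: "v \<in> L"
  obtains \<eta> where "\<And>z. z \<notin> L \<Longrightarrow> \<zeta> (z + v) = \<zeta> z + \<eta>"
proof -
  have "((\<lambda>z. \<zeta> (z + v) - \<zeta> z) has_field_derivative 0) (at x)" if "x \<notin> L" for x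
  proof -
    have "x + v \<notin> L" "x \<notin> L" using that v by (auto simp: lattice_add_iff)
    from DERIV_diff[OF zeta_deriv[OF this(1), unfolded DERIV_shift] zeta_deriv[OF this(2)]] show ?thesis using wp_periodic[OF v] that by simp
  qed
  from zero_derivative_imp_constant[OF this] obtain c where "\<And>x. x \<notin> L \<Longrightarrow> \<zeta> (x + v) - \<zeta> x = c"
    by auto
  then show thesis by (intro that[of c]) (auto simp: algebra_simps)
qed

lemma \<sigma>_lattice:
  assumes "v \<in> L"
  shows "\<sigma> v = 0"
proof (cases "v = 0")
  case False
  have "\<forall>\<^sub>F S in finite_subsets_at_top (L - {0}). finite S \<and> {v} \<subseteq> S \<and> S \<subseteq> L - {0}"
    unfolding eventually_finite_subsets_at_top
    by (rule exI[of _ "{v}"]) (use assms False in auto)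
  then have "\<forall>\<^sub>F S in finite_subsets_at_top (L - {0}). (\<Prod>w\<in>S. weierstrass_E w v) = 0"
    by (rule eventually_mono) (use False in \<open>auto simp: weierstrass_E_eq intro!: bexI[of _ v]\<close>)
  then have "((\<lambda>S. \<Prod>w\<in>S. weierstrass_E w v) \<longlongrightarrow> 0) (finite_subsets_at_top (L - {0}))"
    by (rule tendsto_eventually)
  from tendsto_unique[OF finite_subsets_at_top_neq_bot \<sigma>\<^sub>0_tendsto this] show ?thesis
    by (simp add: \<sigma>_eq)
qed simp

lemma \<sigma>_quasiperiodic:
  assumes v: "v \<in> L"
  obtains c \<eta> where "c \<noteq> 0" "\<And>z. \<sigma> (z + v) = c * exp (\<eta> * z) * \<sigma> z"
proof -
  obtain \<eta> where \<eta>: "\<And>z. z \<notin> L \<Longrightarrow> \<zeta> (z + v) = \<zeta> z + \<eta>"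
    using \<zeta>_quasiperiodic[OF v] by blast
  have "((\<lambda>z. \<sigma> (z + v) * exp (- \<eta> * z) / \<sigma> z) has_field_derivative 0) (at x)" if "x \<notin> L" for x
  proof -
    have x: "x + v \<notin> L" "x \<notin> L" using that v by (auto simp: lattice_add_iff)
    have shift: "((\<lambda>z. \<sigma> (z + v)) has_field_derivative (\<zeta> x + \<eta>) * \<sigma> (x + v)) (at x)"
      using \<sigma>_deriv[OF x(1), unfolded DERIV_shift \<eta>[OF x(2)]] .
    have "((\<lambda>z. \<sigma> (z + v) * exp (- \<eta> * z)) has_field_derivative
        \<zeta> x * (\<sigma> (x + v) * exp (- \<eta> * x))) (at x)"
      by (rule derivative_eq_intros shift refl | simp)+ (simp add: algebra_simps)
    from DERIV_divide[OF this \<sigma>_deriv[OF x(2)] \<sigma>_nonzero[OF x(2)]] show ?thesis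
      by (simp add: mult_ac)
  qed
  from zero_derivative_imp_constant[OF this] obtain c where c: "\<And>x. x \<notin> L \<Longrightarrow> \<sigma> (x + v) * exp (- \<eta> * x) / \<sigma> x = c"
    by auto
  have "- L \<noteq> {}"
    using countable_lattice uncountable_UNIV_complex by (metis Compl_empty_eq double_complement)
  then obtain z where z: "z \<notin> L" by auto
  show thesis
  proof
    show "c \<noteq> 0" using c[of z] z \<sigma>_nonzero[of z] \<sigma>_nonzero[of "z + v"] v by (auto simp: lattice_add_iff)
    show "\<sigma> (x + v) = c * exp (\<eta> * x) * \<sigma> x" for x
    proof (cases "x \<in> L")
      case True
      then show ?thesis using \<sigma>_lattice v by (simp add: lattice_add)
    next
      case False
      then show ?thesis
        using c[of x] \<sigma>_nonzero[of x] by (auto simp: exp_minus field_simps)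
    qed
  qed
qed

lemma \<sigma>_differentiable: "\<sigma> field_differentiable (at z)"
  unfolding \<sigma>_eq[abs_def] using \<sigma>\<^sub>0_differentiable by (intro derivative_intros)

lemma lattice_representative:
  obtains v where "v \<in> L" "norm (z - v) \<le> norm \<omega>\<^sub>1 + norm \<omega>\<^sub>2"
proof -
  define \<tau> where "\<tau> = \<omega>\<^sub>2 / \<omega>\<^sub>1"
  define t where "t = Im (z / \<omega>\<^sub>1) / Im \<tau>"
  define s where "s = Re (z / \<omega>\<^sub>1) - t * Re \<tau>"
  have "z / \<omega>\<^sub>1 = of_real s + of_real t * \<tau>"
    using Im_ratio_nonzero unfolding \<tau>_def[symmetric] by (simp add: complex_eq_iff s_def t_def)
  then have z: "z = of_real s * \<omega>\<^sub>1 + of_real t * \<omega>\<^sub>2"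
    using generator_nonzero by (simp add: \<tau>_def field_simps)
  define v where "v = of_int \<lfloor>s\<rfloor> * \<omega>\<^sub>1 + of_int \<lfloor>t\<rfloor> * \<omega>\<^sub>2"
  have "z - v = of_real (frac s) * \<omega>\<^sub>1 + of_real (frac t) * \<omega>\<^sub>2"
    by (simp add: z v_def frac_def algebra_simps)
  also have "norm \<dots> \<le> norm (of_real (frac s) * \<omega>\<^sub>1) + norm (of_real (frac t) * \<omega>\<^sub>2)"
    by (rule norm_triangle_ineq)
  also have "\<dots> \<le> 1 * norm \<omega>\<^sub>1 + 1 * norm \<omega>\<^sub>2"
    unfolding norm_mult by (intro add_mono mult_right_mono)
      (auto simp: frac_ge_0 less_imp_le[OF frac_lt_1])
  finally have "norm (z - v) \<le> norm \<omega>\<^sub>1 + norm \<omega>\<^sub>2" by simp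
  moreover have "v \<in> L" by (auto simp: v_def period_lattice_def)
  ultimately show thesis using that by blast
qed

text \<open>
  Every value is taken on a compact set, so Liouville's theorem applies.
\<close>

lemma holomorphic_periodic_constant:
  assumes hol: "f holomorphic_on UNIV" and per: "\<And>v z. v \<in> L \<Longrightarrow> f (z + v) = f z"
  shows "f z = f u"
proof -
  let ?K = "cball 0 (norm \<omega>\<^sub>1 + norm \<omega>\<^sub>2)"
  have "compact (f ` ?K)"
    using hol by (intro compact_continuous_image holomorphic_on_imp_continuous_on)
      (auto intro: holomorphic_on_subset)
  moreover have "range f \<subseteq> f ` ?K"
  proof clarify
    fix z
    obtain v where "v \<in> L" "norm (z - v) \<le> norm \<omega>\<^sub>1 + norm \<omega>\<^sub>2" by (rule lattice_representative)
    then show "f z \<in> f ` ?K"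
      using per[of v "z - v"] by (intro image_eqI[of _ _ "z - v"]) auto
  qed
  ultimately have "bounded (range f)" using compact_imp_bounded bounded_subset by blast
  then show ?thesis using Liouville_theorem[OF hol] by (metis UNIV_I constant_on_def)
qed

section \<open>The product formula for \<open>\<wp>(z) - \<wp>(u)\<close> and the addition theorem for \<open>\<zeta>\<close>\<close>

text \<open>
  For fixed \<open>u\<close>, let \<open>D(z)\<close> be \<open>\<wp>(z)\<close> plus the quotient of \<open>\<sigma>\<close> values. The constants of
  quasi-periodicity cancel, so \<open>D\<close> is doubly periodic. Near \<open>0\<close> the function \<open>z\<^sup>2 D(z)\<close> is even and vanishes
  at \<open>0\<close>, hence to second order, so the singularities of \<open>D\<close> are removable and \<open>D\<close> is constant. At \<open>z = u\<close>
  the quotient vanishes.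
\<close>

theorem wp_diff_eq_\<sigma>_quotient:
  assumes z: "z \<notin> L" and u: "u \<notin> L"
  shows "wp z - wp u = - (\<sigma> (z + u) * \<sigma> (z - u)) / ((\<sigma> z)\<^sup>2 * (\<sigma> u)\<^sup>2)"
proof -
  define D where "D z = wp z + \<sigma> (z + u) * \<sigma> (z - u) / ((\<sigma> z)\<^sup>2 * (\<sigma> u)\<^sup>2)" for z
  define W where "W z = (\<Sum>\<^sub>\<infinity>w\<in>L - {0}. 1 / (z - w)^2 - 1 / w^2)" for z
  define H where "H z = 1 + z\<^sup>2 * W z + \<sigma> (z + u) * \<sigma> (z - u) / ((\<sigma>\<^sub>0 z)\<^sup>2 * (\<sigma> u)\<^sup>2)" for z
  define U where "U = - (L - {0})"
  have \<sigma>u: "\<sigma> u \<noteq> 0" using \<sigma>_nonzero[OF u] .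
  have openU: "open U" unfolding U_def by (rule open_complement_lattice) auto
  have [simp]: "0 \<in> U" by (simp add: U_def)
  have \<sigma>_shift: "(\<lambda>z. \<sigma> (z + v)) field_differentiable (at x)" for v x
    using \<sigma>_differentiable[of "x + v"] by (auto simp: field_differentiable_def DERIV_shift)
  have "W field_differentiable (at x)" if "x \<in> U" for x
    using wp_sum(3)[of x] that unfolding W_def[abs_def] U_def field_differentiable_def by auto
  moreover have "\<sigma>\<^sub>0 x \<noteq> 0" if "x \<in> U" for x
    using \<sigma>\<^sub>0_nonzero[of x] that by (auto simp: U_def)
  ultimately have "H field_differentiable (at x)" if "x \<in> U" for x
    unfolding H_def[abs_def] using that \<sigma>_shift[of u] \<sigma>_shift[of "- u"] \<sigma>u
    by (auto intro!: derivative_intros \<sigma>\<^sub>0_differentiable)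
  then have holH: "H holomorphic_on U"
    by (auto simp: holomorphic_on_def intro: field_differentiable_at_within)
  have H0: "H 0 = 0"
    using \<sigma>u by (simp add: H_def \<sigma>\<^sub>0_0 \<sigma>_minus power2_eq_square)
  have W_even: "W (- x) = W x" for x
    using wp_minus[of x] by (simp add: weierstrass_p_def W_def)
  have H_even: "H (- x) = H x" for x
  proof -
    have "\<sigma> (- x + u) = - \<sigma> (x - u)" "\<sigma> (- x - u) = - \<sigma> (x + u)"
      using \<sigma>_minus[of "x - u"] \<sigma>_minus[of "x + u"] by simp_all
    then show ?thesis by (simp add: H_def W_even \<sigma>\<^sub>0_minus mult.commute)
  qed
  \<comment> \<open>The derivative of an even function is odd.\<close>
  have dH: "deriv H 0 = 0"
  proof -
    have d: "(H has_field_derivative deriv H 0) (at 0)"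
      using holH openU by (intro holomorphic_derivI) auto
    have "((\<lambda>x. H (- x)) has_field_derivative deriv H 0 * (- 1)) (at 0)"
      by (rule DERIV_chain2[of H]) (use d in \<open>auto intro!: derivative_eq_intros\<close>)
    then have "(H has_field_derivative - deriv H 0) (at 0)" by (simp add: H_even)
    from DERIV_unique[OF d this] show ?thesis by simp
  qed
  \<comment> \<open>Divided differences at \<open>0\<close> stay holomorphic; \<open>H2\<close> extends \<open>H(z) / z\<^sup>2\<close>.\<close>
  define H1 where "H1 x = (if x = 0 then deriv H 0 else (H x - H 0) / (x - 0))" for x
  define H2 where "H2 x = (if x = 0 then deriv H1 0 else (H1 x - H1 0) / (x - 0))" for x
  have "H1 holomorphic_on U"
    unfolding H1_def[abs_def] by (rule pole_lemma_open[OF holH openU])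
  then have holH2: "H2 holomorphic_on U"
    unfolding H2_def[abs_def] by (rule pole_lemma_open[OF _ openU])
  have D_H2: "D x = H2 x" if "x \<in> U" "x \<noteq> 0" for x
  proof -
    have "H1 x = H x / x" "H1 0 = 0" using that(2) by (auto simp: H1_def H0 dH)
    then have "H2 x = H x / x\<^sup>2" using that(2) by (simp add: H2_def power2_eq_square)
    moreover have "D x = H x / x\<^sup>2"
      using that(2) unfolding D_def H_def weierstrass_p_def W_def[symmetric] \<sigma>_eq[of x]
      by (simp add: add_divide_distrib power_mult_distrib mult.assoc mult.commute mult.left_commute)
    ultimately show ?thesis by simp
  qed
  have D_per: "D (x + v) = D x" if v: "v \<in> L" and x: "x \<notin> L" for v x
  proof -
    obtain c \<eta> where c: "c \<noteq> 0" "\<And>z. \<sigma> (z + v) = c * exp (\<eta> * z) * \<sigma> z" by (rule \<sigma>_quasiperiodic[OF v]) (rule that)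
    have "\<sigma> (x + v + u) * \<sigma> (x + v - u) = (c * exp (\<eta> * x))\<^sup>2 * (\<sigma> (x + u) * \<sigma> (x - u))"
      using c(2)[of "x + u"] c(2)[of "x - u"]
      by (simp add: algebra_simps power2_eq_square flip: exp_add)
    then show ?thesis
      using c(1) by (simp add: D_def wp_periodic[OF v x] c(2)[of x] power_mult_distrib)
  qed
  define G where "G x = (if x \<in> L then H2 0 else D x)" for x
  have "G field_differentiable (at x)" for x
  proof (cases "x \<in> L")
    case False
    have "D field_differentiable (at x)"
      unfolding D_def[abs_def] using False \<sigma>_shift[of u] \<sigma>_shift[of "- u"] \<sigma>u \<sigma>_nonzero[OF False]
      by (auto intro!: derivative_intros \<sigma>_differentiable wp_differentiable)
    then obtain d where "(D has_field_derivative d) (at x)" by (auto simp: field_differentiable_def)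
    then have "(G has_field_derivative d) (at x)"
      by (rule has_field_derivative_transform_within_open[OF _ open_complement_lattice[OF order_refl]])
        (use False in \<open>auto simp: G_def\<close>)
    then show ?thesis by (auto simp: field_differentiable_def)
  next
    case True
    have "(H2 has_field_derivative deriv H2 0) (at (x + - x))"
      using holH2 openU by (auto intro: holomorphic_derivI)
    then have "((\<lambda>y. H2 (y + - x)) has_field_derivative deriv H2 0) (at x)"
      by (simp only: DERIV_shift)
    then have "(G has_field_derivative deriv H2 0) (at x)"
    proof (rule has_field_derivative_transform_within_open)
      show "open ((\<lambda>y. x + y) ` U)" using openU by (rule open_translation)
      show "x \<in> (\<lambda>y. x + y) ` U" by (intro image_eqI[of _ _ 0]) auto
      fix y assume "y \<in> (\<lambda>y. x + y) ` U"
      then have y: "y - x \<in> U" by auto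
      show "H2 (y + - x) = G y"
      proof (cases "y \<in> L")
        case True
        then have "y - x \<in> L" using \<open>x \<in> L\<close> lattice_diff by blast
        then have "y = x" using y by (auto simp: U_def)
        then show ?thesis using \<open>x \<in> L\<close> by (simp add: G_def)
      next
        case False
        then have "y - x \<notin> L" using lattice_add[of "y - x" x] \<open>x \<in> L\<close> by auto
        then have "y - x \<noteq> 0" by (metis lattice_0)
        then show ?thesis
          using D_H2[OF y] D_per[OF \<open>x \<in> L\<close> \<open>y - x \<notin> L\<close>] False by (simp add: G_def)
      qed
    qed
    then show ?thesis by (auto simp: field_differentiable_def)
  qed
  then have "G holomorphic_on UNIV" by (simp add: holomorphic_on_def)
  moreover have "G (x + v) = G x" if "v \<in> L" for v x
    using D_per[OF that] that by (auto simp: G_def lattice_add_iff)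
  ultimately have "G z = G u" by (rule holomorphic_periodic_constant)
  then have "D z = wp u" using z u by (simp add: G_def D_def)
  then show ?thesis by (simp add: D_def algebra_simps)
qed

end

context complex_lattice
begin

lemma deriv_wp_minus:
  assumes "z \<notin> L"
  shows "deriv wp (- z) = - deriv wp z"
proof -
  have "((\<lambda>x. wp (- x)) has_field_derivative deriv wp (- z) * (- 1)) (at z)"
    by (rule DERIV_chain2[of wp]) (use assms in \<open>auto intro!: derivative_eq_intros wp_deriv\<close>)
  then have "(wp has_field_derivative - deriv wp (- z)) (at z)" by (simp add: wp_minus)
  from DERIV_unique[OF this wp_deriv[OF assms]] show ?thesis by (metis minus_minus)
qed

lemma \<sigma>_shift_deriv:
  assumes "z + u \<notin> L"
  shows "((\<lambda>z. \<sigma> (z + u)) has_field_derivative \<zeta> (z + u) * \<sigma> (z + u)) (at z)"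
  using \<sigma>_deriv[OF assms, unfolded DERIV_shift] .

text \<open>
  The logarithmic derivative of the product formula.
\<close>

lemma deriv_wp_eq_\<zeta>:
  assumes z: "z \<notin> L" and u: "u \<notin> L" and "z + u \<notin> L" "z - u \<notin> L"
  shows "deriv wp z = (wp z - wp u) * (\<zeta> (z + u) + \<zeta> (z - u) - 2 * \<zeta> z)"
proof -
  let ?R = "\<lambda>z. - (\<sigma> (z + u) * \<sigma> (z - u)) / ((\<sigma> z)\<^sup>2 * (\<sigma> u)\<^sup>2)"
  have nz: "\<sigma> z \<noteq> 0" "\<sigma> u \<noteq> 0" using z u \<sigma>_nonzero by auto
  have "((\<lambda>z. \<sigma> (z - u)) has_field_derivative \<zeta> (z - u) * \<sigma> (z - u)) (at z)"
    using \<sigma>_shift_deriv[of z "- u"] assms by simp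
  note 1 = DERIV_minus[OF DERIV_mult[OF \<sigma>_shift_deriv[OF assms(3)] this]]
  have 2: "((\<lambda>z. (\<sigma> z)\<^sup>2 * (\<sigma> u)\<^sup>2) has_field_derivative 2 * \<zeta> z * ((\<sigma> z)\<^sup>2 * (\<sigma> u)\<^sup>2)) (at z)"
    by (rule derivative_eq_intros \<sigma>_deriv z refl)+ (simp add: power2_eq_square)
  have nz2: "(\<sigma> z)\<^sup>2 * (\<sigma> u)\<^sup>2 \<noteq> 0" using nz by simp
  have "(?R has_field_derivative ?R z * (\<zeta> (z + u) + \<zeta> (z - u) - 2 * \<zeta> z)) (at z)"
  proof (rule DERIV_cong[OF DERIV_divide[OF 1 2 nz2]])
    show "(- (\<zeta> (z + u) * \<sigma> (z + u) * \<sigma> (z - u) + \<zeta> (z - u) * \<sigma> (z - u) * \<sigma> (z + u)) * ((\<sigma> z)\<^sup>2 * (\<sigma> u)\<^sup>2)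
        - - (\<sigma> (z + u) * \<sigma> (z - u)) * (2 * \<zeta> z * ((\<sigma> z)\<^sup>2 * (\<sigma> u)\<^sup>2))) /
        ((\<sigma> z)\<^sup>2 * (\<sigma> u)\<^sup>2 * ((\<sigma> z)\<^sup>2 * (\<sigma> u)\<^sup>2)) = ?R z * (\<zeta> (z + u) + \<zeta> (z - u) - 2 * \<zeta> z)"
      using nz2 by (simp add: divide_simps) (simp add: algebra_simps)
  qed
  then have "((\<lambda>z. wp z - wp u) has_field_derivative ?R z * (\<zeta> (z + u) + \<zeta> (z - u) - 2 * \<zeta> z)) (at z)"
    by (rule has_field_derivative_transform_within_open[OF _ open_complement_lattice[OF order_refl]])
      (use z wp_diff_eq_\<sigma>_quotient[OF _ u] in auto)
  moreover have "((\<lambda>z. wp z - wp u) has_field_derivative deriv wp z) (at z)"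
    using DERIV_diff[OF wp_deriv[OF z] DERIV_const] by simp
  ultimately show ?thesis
    unfolding wp_diff_eq_\<sigma>_quotient[OF z u] by (rule DERIV_unique[symmetric])
qed

text \<open>
  The logarithmic derivatives of the product formula in \<open>z\<close> and in \<open>u\<close>, added up.
\<close>

theorem \<zeta>_addition:
  assumes "z \<notin> L" "u \<notin> L" "z + u \<notin> L" "z - u \<notin> L"
  shows "2 * (\<zeta> (z - u) - \<zeta> z + \<zeta> u) * (wp z - wp u) = deriv wp z + deriv wp u"
proof -
  have "u - z \<notin> L" using assms(4) lattice_minus[of "u - z"] by auto
  moreover have "\<zeta> (u - z) = - \<zeta> (z - u)" using \<zeta>_minus[of "z - u"] by simp
  ultimately have "deriv wp u = (wp u - wp z) * (\<zeta> (z + u) - \<zeta> (z - u) - 2 * \<zeta> u)"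
    using deriv_wp_eq_\<zeta>[of u z] assms by (simp add: add.commute)
  then show ?thesis
    unfolding deriv_wp_eq_\<zeta>[OF assms] by (simp add: algebra_simps)
qed

end

section \<open>The cubic of the Delaunay-type potential\<close>

text \<open>
  The right-hand side of the equation is \<open>16 + 4 (\<wp> - M)\<^sup>2 (\<wp> + 2 M)\<close>, so the line \<open>\<wp>' = 4\<close> touches the
  cubic at the point of \<open>\<alpha>\<close> and meets it again where \<open>\<wp> = - 2 M\<close>.
\<close>

locale delaunay_lattice = complex_lattice +
  fixes M \<alpha> :: complex
  assumes wp_ode: "\<And>z. z \<notin> L \<Longrightarrow> (deriv wp z)^2 = 4 * wp z ^ 3 - 12 * M^2 * wp z + 8 * (M^3 + 2)"
    and \<alpha>_notin: "\<alpha> \<notin> L" and wp_\<alpha>: "wp \<alpha> = M" and deriv_wp_\<alpha>: "deriv wp \<alpha> = 4"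
begin

definition p :: "complex \<Rightarrow> complex" where "p z = wp z - M"

lemma p_deriv: "z \<notin> L \<Longrightarrow> (p has_field_derivative deriv wp z) (at z)"
  unfolding p_def[abs_def] using DERIV_diff[OF wp_deriv DERIV_const] by simp

text \<open>
  These are the points off the poles and zeros of \<open>\<wp> - M\<close> (\<open>regular_iff\<close>). Describing them by the lattice
  shows that their complement is closed and countable.
\<close>

definition regular :: "complex set" where
  "regular = {z. z \<notin> L \<and> z + \<alpha> \<notin> L \<and> z - \<alpha> \<notin> L}"

lemma p_eq_0_iff: "z \<notin> L \<Longrightarrow> p z = 0 \<longleftrightarrow> z + \<alpha> \<in> L \<or> z - \<alpha> \<in> L"
  using wp_diff_eq_\<sigma>_quotient[of z \<alpha>] \<alpha>_notin \<sigma>_nonzero[of "z + \<alpha>"] \<sigma>_nonzero[of "z - \<alpha>"]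
    \<sigma>_nonzero[of z] \<sigma>_nonzero[of \<alpha>] \<sigma>_lattice
  by (auto simp: p_def wp_\<alpha>)

lemma regular_iff: "z \<in> regular \<longleftrightarrow> z \<notin> L \<and> p z \<noteq> 0"
  using p_eq_0_iff[of z] by (auto simp: regular_def)

lemma wp_deriv_squared:
  "z \<notin> L \<Longrightarrow> (deriv wp z)\<^sup>2 = 4 * p z ^ 3 + 12 * M * (p z)\<^sup>2 + 16"
  unfolding wp_ode p_def by (simp add: algebra_simps power2_eq_square power3_eq_cube)

text \<open>
  Differentiating the equation gives \<open>2 \<wp>' \<wp>'' = 2 \<wp>' (6 p\<^sup>2 + 12 M p)\<close>. Where \<open>\<wp>'\<close> vanishes it cannot be
  cancelled; there the identity theorem extends the result from the open set on which \<open>\<wp>' \<noteq> 0\<close>.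
\<close>

lemma wp_second_deriv:
  assumes "z \<notin> L"
  shows "(deriv wp has_field_derivative 6 * (p z)\<^sup>2 + 12 * M * p z) (at z)"
proof -
  let ?U = "- L" and ?dd = "deriv (deriv wp)"
  have openU: "open ?U" by (rule open_complement_lattice) simp
  have holo: "deriv wp holomorphic_on ?U" by (rule holomorphic_deriv[OF wp_holomorphic openU])
  have dd: "(deriv wp has_field_derivative ?dd x) (at x)" if "x \<notin> L" for x
    by (rule holomorphic_derivI[OF holo openU]) (use that in auto)
  define N where "N = {x \<in> ?U. deriv wp x \<noteq> 0}"
  have "continuous_on ?U (deriv wp)" by (rule holomorphic_on_imp_continuous_on[OF holo])
  then have "open (?U \<inter> deriv wp -` (- {0}))"
    by (rule continuous_open_preimage[OF _ openU]) (rule open_Compl[OF closed_singleton])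
  moreover have "?U \<inter> deriv wp -` (- {0}) = N" by (auto simp only: N_def)
  ultimately have "open N" by simp
  have eq_on_N: "?dd x = 6 * (p x)\<^sup>2 + 12 * M * p x" if x: "x \<in> N" for x
  proof -
    have xL: "x \<notin> L" and nz: "deriv wp x \<noteq> 0" using x by (auto simp: N_def)
    have "((\<lambda>x. (deriv wp x)\<^sup>2) has_field_derivative 2 * deriv wp x * ?dd x) (at x)"
      by (rule derivative_eq_intros dd xL refl)+ simp
    moreover have "((\<lambda>x. 4 * p x ^ 3 + 12 * M * (p x)\<^sup>2 + 16) has_field_derivative
        2 * deriv wp x * (6 * (p x)\<^sup>2 + 12 * M * p x)) (at x)"
      by (rule derivative_eq_intros p_deriv xL refl)+ (simp add: algebra_simps power2_eq_square)
    then have "((\<lambda>x. (deriv wp x)\<^sup>2) has_field_derivative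
        2 * deriv wp x * (6 * (p x)\<^sup>2 + 12 * M * p x)) (at x)"
      by (rule has_field_derivative_transform_within_open[OF _ openU]) (use xL wp_deriv_squared in auto)
    ultimately have "2 * deriv wp x * ?dd x = 2 * deriv wp x * (6 * (p x)\<^sup>2 + 12 * M * p x)"
      by (rule DERIV_unique)
    then show ?thesis using nz by simp
  qed
  have "?dd z = 6 * (p z)\<^sup>2 + 12 * M * p z"
  proof (rule analytic_continuation_open[OF \<open>open N\<close> openU _ connected_complement_lattice,
        where f = ?dd and g = "\<lambda>z. 6 * (p z)\<^sup>2 + 12 * M * p z"])
    show "N \<noteq> {}" using \<alpha>_notin deriv_wp_\<alpha> by (auto simp: N_def)
    show "?dd holomorphic_on ?U" by (rule holomorphic_deriv[OF holo openU])
    show "(\<lambda>z. 6 * (p z)\<^sup>2 + 12 * M * p z) holomorphic_on ?U"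
      unfolding p_def by (intro holomorphic_intros wp_holomorphic)
  qed (use assms eq_on_N in \<open>auto simp: N_def\<close>)
  then show ?thesis using dd[OF assms] by simp
qed

lemma \<zeta>_difference:
  assumes "z \<in> regular"
  shows "\<zeta> (z - \<alpha>) - \<zeta> z + \<zeta> \<alpha> = (deriv wp z + 4) / (2 * p z)"
    and "\<zeta> (z + \<alpha>) - \<zeta> z - \<zeta> \<alpha> = (deriv wp z - 4) / (2 * p z)"
proof -
  have nz: "p z \<noteq> 0" using assms regular_iff by auto
  show "\<zeta> (z - \<alpha>) - \<zeta> z + \<zeta> \<alpha> = (deriv wp z + 4) / (2 * p z)"
    using \<zeta>_addition[of z \<alpha>] assms \<alpha>_notin nz by (simp add: regular_def p_def wp_\<alpha> deriv_wp_\<alpha> field_simps)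
  show "\<zeta> (z + \<alpha>) - \<zeta> z - \<zeta> \<alpha> = (deriv wp z - 4) / (2 * p z)"
    using \<zeta>_addition[of z "- \<alpha>"] assms \<alpha>_notin nz
    by (simp add: regular_def p_def wp_minus \<zeta>_minus deriv_wp_minus wp_\<alpha> deriv_wp_\<alpha> field_simps)
qed

lemma closed_translated_lattice: "closed {z. z + u \<in> L}"
proof -
  have "{z. z + u \<in> L} = (\<lambda>z. z + u) -` L" by auto
  then show ?thesis
    using closed_vimage[OF closed_lattice_subset[OF order_refl], of "\<lambda>z. z + u"]
    by (simp add: continuous_intros)
qed

lemma open_regular: "open regular"
proof -
  have "regular = - ({z. z + 0 \<in> L} \<union> {z. z + \<alpha> \<in> L} \<union> {z. z + - \<alpha> \<in> L})"
    by (auto simp: regular_def)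
  then show ?thesis using closed_translated_lattice by (metis closed_Un open_Compl)
qed

lemma countable_complement_regular: "countable (- regular)"
proof -
  have "- regular \<subseteq> L \<union> (\<lambda>z. z - \<alpha>) ` L \<union> (\<lambda>z. z + \<alpha>) ` L"
    by (auto simp: regular_def image_iff) (metis add_diff_cancel diff_add_cancel)+
  then show ?thesis
    by (rule countable_subset) (intro countable_Un countable_image countable_lattice)
qed

text \<open>
  Differentiate \<open>\<zeta>(z + \<alpha>) - \<zeta>(z) - \<zeta>(\<alpha>) = (\<wp>'(z) - 4) / (2 p(z))\<close>: the left-hand side becomes
  \<open>p(z) - p(z + \<alpha>)\<close>, the right-hand side a rational expression in \<open>p\<close> and \<open>\<wp>'\<close>, in which the equation
  of the cubic eliminates the square of \<open>\<wp>'\<close>.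
\<close>

lemma wp_add_\<alpha>:
  assumes "z \<in> regular"
  shows "deriv wp z - 4 = - ((p z)\<^sup>2 * p (z + \<alpha>)) / 2"
proof -
  have z: "z \<notin> L" "z + \<alpha> \<notin> L" using assms by (auto simp: regular_def)
  have nz: "p z \<noteq> 0" using assms regular_iff by auto
  have "((\<lambda>z. \<zeta> (z + \<alpha>) - \<zeta> z - \<zeta> \<alpha>) has_field_derivative p z - p (z + \<alpha>)) (at z)"
    using DERIV_diff[OF DERIV_diff[OF zeta_deriv[OF z(2), unfolded DERIV_shift] zeta_deriv[OF z(1)]] DERIV_const]
    by (simp add: p_def)
  moreover have "((\<lambda>z. (deriv wp z - 4) / (2 * p z)) has_field_derivative
      ((6 * (p z)\<^sup>2 + 12 * M * p z) * (2 * p z) - (deriv wp z - 4) * (2 * deriv wp z)) / (2 * p z * (2 * p z))) (at z)"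
    using nz by (auto intro!: derivative_eq_intros wp_second_deriv p_deriv z)
  then have "((\<lambda>z. \<zeta> (z + \<alpha>) - \<zeta> z - \<zeta> \<alpha>) has_field_derivative
      ((6 * (p z)\<^sup>2 + 12 * M * p z) * (2 * p z) - (deriv wp z - 4) * (2 * deriv wp z)) / (2 * p z * (2 * p z))) (at z)"
    by (rule has_field_derivative_transform_within_open[OF _ open_regular assms]) (simp add: \<zeta>_difference)
  ultimately have "p z - p (z + \<alpha>) =
      ((6 * (p z)\<^sup>2 + 12 * M * p z) * (2 * p z) - (deriv wp z - 4) * (2 * deriv wp z)) / (2 * p z * (2 * p z))"
    by (rule DERIV_unique)
  then have "(p z - p (z + \<alpha>)) * (2 * p z * (2 * p z)) =
      (6 * (p z)\<^sup>2 + 12 * M * p z) * (2 * p z) - (deriv wp z - 4) * (2 * deriv wp z)"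
    using nz by (simp only: nonzero_eq_divide_eq) simp
  \<comment> \<open>Clearing the denominator and inserting the equation of the cubic.\<close>
  then have "8 * (deriv wp z - 4) = 8 * (- ((p z)\<^sup>2 * p (z + \<alpha>)) / 2)"
    using wp_deriv_squared[OF z(1)] by (simp add: power2_eq_square power3_eq_cube) algebra
  then show ?thesis by (metis mult_left_cancel zero_neq_numeral)
qed

text \<open>
  The product formula at \<open>z\<close> and at \<open>z + \<alpha>\<close>, inserted into \<open>wp_add_\<alpha>\<close>. It expresses that, modulo the
  lattice, the zeros of \<open>\<wp>' - 4\<close> are \<open>\<alpha>\<close>, counted twice, and \<open>- 2 \<alpha>\<close>, against a triple pole at \<open>0\<close>.
\<close>

lemma \<sigma>_add_double_\<alpha>:
  assumes "z \<in> regular"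
  shows "\<sigma> (z + 2 * \<alpha>) / \<sigma> z = 2 * \<sigma> \<alpha> ^ 6 * (deriv wp z - 4) / (\<sigma> (z - \<alpha>) / \<sigma> z)\<^sup>2"
proof -
  have z: "z \<notin> L" "z + \<alpha> \<notin> L" "z - \<alpha> \<notin> L" using assms by (auto simp: regular_def)
  have nz: "\<sigma> z \<noteq> 0" "\<sigma> (z + \<alpha>) \<noteq> 0" "\<sigma> (z - \<alpha>) \<noteq> 0" "\<sigma> \<alpha> \<noteq> 0"
    using z \<alpha>_notin \<sigma>_nonzero by auto
  have 1: "p z = - (\<sigma> (z + \<alpha>) * \<sigma> (z - \<alpha>)) / ((\<sigma> z)\<^sup>2 * (\<sigma> \<alpha>)\<^sup>2)"
    using wp_diff_eq_\<sigma>_quotient[OF z(1) \<alpha>_notin] by (simp add: p_def wp_\<alpha>)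
  have 2: "p (z + \<alpha>) = - (\<sigma> (z + 2 * \<alpha>) * \<sigma> z) / ((\<sigma> (z + \<alpha>))\<^sup>2 * (\<sigma> \<alpha>)\<^sup>2)"
    using wp_diff_eq_\<sigma>_quotient[OF z(2) \<alpha>_notin] by (simp add: p_def wp_\<alpha> add.assoc)
  show ?thesis
    unfolding wp_add_\<alpha>[OF assms] 1 2 using nz
    by (simp add: power_divide power_mult_distrib divide_simps) (simp add: eval_nat_numeral)
qed

end

section \<open>Matrix exponentials and linear systems of trace zero\<close>

lemma norm_matpow_le:
  fixes A :: "complex^'n^'n"
  shows "norm (matpow A n $ i $ j) \<le> (\<Sum>i\<in>UNIV. \<Sum>l\<in>UNIV. norm (A $ i $ l)) ^ n"
proof (induction n arbitrary: i)
  case 0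
  show ?case by (simp add: mat_def)
next
  case (Suc n)
  let ?C = "\<Sum>i\<in>UNIV. \<Sum>l\<in>UNIV. norm (A $ i $ l)"
  have "norm (matpow A (Suc n) $ i $ j) \<le> (\<Sum>l\<in>UNIV. norm (A $ i $ l) * norm (matpow A n $ l $ j))"
    by (simp add: matrix_matrix_mult_def norm_mult flip: norm_mult) (rule norm_sum)
  also have "\<dots> \<le> (\<Sum>l\<in>UNIV. norm (A $ i $ l) * ?C ^ n)"
    by (intro sum_mono mult_left_mono Suc) auto
  also have "\<dots> = (\<Sum>l\<in>UNIV. norm (A $ i $ l)) * ?C ^ n"
    by (simp add: sum_distrib_right)
  also have "\<dots> \<le> ?C * ?C ^ n"
    by (intro mult_right_mono member_le_sum[of i UNIV "\<lambda>i. \<Sum>l\<in>UNIV. norm (A $ i $ l)"])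
      (auto intro!: sum_nonneg zero_le_power)
  finally show ?case by simp
qed

lemma matexp_entry_sums:
  fixes A :: "complex^'n^'n"
  shows "(\<lambda>n. (1 / fact n) *\<^sub>R matpow A n $ i $ j) sums matexp A $ i $ j"
proof -
  define C where "C = (\<Sum>i\<in>UNIV. \<Sum>l\<in>UNIV. norm (A $ i $ l))"
  have summable: "summable (\<lambda>n. (1 / fact n) *\<^sub>R matpow A n $ i $ j)" for i j
  proof (rule summable_comparison_test')
    show "summable (\<lambda>n. C ^ n /\<^sub>R fact n)" by (rule sums_summable[OF exp_converges])
    show "norm ((1 / fact n) *\<^sub>R matpow A n $ i $ j) \<le> C ^ n /\<^sub>R fact n" if "0 \<le> n" for n
      using norm_matpow_le[of A n i j] by (simp add: C_def divide_inverse mult.commute mult_right_mono)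
  qed
  define S where "S = (\<chi> i j. \<Sum>n. (1 / fact n) *\<^sub>R matpow A n $ i $ j)"
  have "(\<lambda>n. (1 / fact n) *\<^sub>R matpow A n) sums S"
    unfolding sums_def
    by (intro vec_tendstoI)
      (use summable_LIMSEQ[OF summable] in \<open>simp add: S_def\<close>)
  then have "matexp A = S" unfolding matexp_def by (rule sums_unique[symmetric])
  then show ?thesis using summable_sums[OF summable] by (simp add: S_def)
qed

text \<open>
  Left eigenvectors replace a closed form of the exponential: they are applied term by term to the series.
\<close>

lemma matexp_left_eigenvector:
  fixes A :: "complex^'n^'n"
  assumes eig: "\<And>j. (\<Sum>i\<in>UNIV. l i * A $ i $ j) = c * l j"
  shows "(\<Sum>i\<in>UNIV. l i * matexp A $ i $ j) = exp c * l j"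
proof -
  have pow: "(\<Sum>i\<in>UNIV. l i * matpow A n $ i $ j) = c ^ n * l j" for n
  proof (induction n)
    case 0
    show ?case by (simp add: mat_def if_distrib cong: if_cong)
  next
    case (Suc n)
    have "(\<Sum>i\<in>UNIV. l i * matpow A (Suc n) $ i $ j)
        = (\<Sum>i\<in>UNIV. \<Sum>h\<in>UNIV. l i * A $ i $ h * matpow A n $ h $ j)"
      by (simp add: matrix_matrix_mult_def sum_distrib_left mult.assoc)
    also have "\<dots> = (\<Sum>h\<in>UNIV. \<Sum>i\<in>UNIV. l i * A $ i $ h * matpow A n $ h $ j)"
      by (rule sum.swap)
    also have "\<dots> = (\<Sum>h\<in>UNIV. c * l h * matpow A n $ h $ j)"
      by (simp add: eig flip: sum_distrib_right)
    also have "\<dots> = c * (\<Sum>h\<in>UNIV. l h * matpow A n $ h $ j)"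
      by (simp add: sum_distrib_left mult.assoc)
    finally show ?case using Suc by simp
  qed
  have "(\<lambda>n. \<Sum>i\<in>UNIV. l i * ((1 / fact n) *\<^sub>R matpow A n $ i $ j)) sums
      (\<Sum>i\<in>UNIV. l i * matexp A $ i $ j)"
    by (intro sums_sum sums_mult matexp_entry_sums)
  moreover have "(\<Sum>i\<in>UNIV. l i * ((1 / fact n) *\<^sub>R matpow A n $ i $ j)) = c ^ n /\<^sub>R fact n * l j" for n
  proof -
    have "(\<Sum>i\<in>UNIV. l i * ((1 / fact n) *\<^sub>R matpow A n $ i $ j))
        = (1 / fact n) *\<^sub>R (\<Sum>i\<in>UNIV. l i * matpow A n $ i $ j)"
      by (simp add: scaleR_sum_right)
    then show ?thesis by (simp add: pow divide_inverse)
  qed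
  ultimately show ?thesis
    using sums_mult2[OF exp_converges[of c], of "l j"] by (auto dest: sums_unique2)
qed

text \<open>
  Liouville's formula: the derivative of the determinant is the determinant times the trace.
\<close>

lemma det_constant_of_traceless:
  fixes A N :: "complex \<Rightarrow> complex^3^3"
  assumes \<Omega>: "open \<Omega>" "connected \<Omega>"
    and ode: "\<And>t i j. t \<in> \<Omega> \<Longrightarrow>
      ((\<lambda>s. A s $ i $ j) has_field_derivative (A t ** N t) $ i $ j) (at t)"
    and traceless: "\<And>t. t \<in> \<Omega> \<Longrightarrow> trace (N t) = 0"
    and "s \<in> \<Omega>" "t \<in> \<Omega>"
  shows "det (A s) = det (A t)"
proof -
  have "((\<lambda>s. det (A s)) has_field_derivative 0) (at t)" if t: "t \<in> \<Omega>" for t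
  proof -
    have tr: "N t $ 3 $ 3 = - N t $ 1 $ 1 - N t $ 2 $ 2"
      using traceless[OF t] by (simp add: trace_def sum_3 algebra_simps eq_neg_iff_add_eq_0)
    show ?thesis
      unfolding det_3
      by (rule derivative_eq_intros ode[OF t] refl)+
        (simp add: matrix_matrix_mult_def sum_3 tr algebra_simps)
  qed
  then have "(\<lambda>s. det (A s)) constant_on \<Omega>"
    using \<Omega> by (intro has_field_derivative_0_imp_constant_on)
  then show ?thesis using assms(5,6) by (auto simp: constant_on_def)
qed

text \<open>
  Replacing the \<open>i\<close>-th row of \<open>F\<close> by \<open>r\<close> gives another solution matrix, whose constant determinant is the
  \<open>i\<close>-th entry of \<open>r(0)\<close>. By Cramer's rule these determinants are the coefficients of \<open>r\<close> in the rows of \<open>F\<close>.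
\<close>

lemma row_solution_eq_frame:
  fixes F N :: "complex \<Rightarrow> complex^3^3" and r :: "complex \<Rightarrow> complex^3"
  assumes \<Omega>: "open \<Omega>" "connected \<Omega>" "0 \<in> \<Omega>"
    and F0: "F 0 = mat 1"
    and ode: "\<And>t i j. t \<in> \<Omega> \<Longrightarrow>
      ((\<lambda>s. F s $ i $ j) has_field_derivative (F t ** N t) $ i $ j) (at t)"
    and row: "\<And>t j. t \<in> \<Omega> \<Longrightarrow>
      ((\<lambda>s. r s $ j) has_field_derivative (\<Sum>i\<in>UNIV. r t $ i * N t $ i $ j)) (at t)"
    and traceless: "\<And>t. t \<in> \<Omega> \<Longrightarrow> trace (N t) = 0"
    and t: "t \<in> \<Omega>"
  shows "r t $ j = (\<Sum>i\<in>UNIV. r 0 $ i * F t $ i $ j)"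
proof -
  define A where "A i t = (\<chi> h. if h = i then r t else F t $ h)" for i :: 3 and t
  have "((\<lambda>s. A i s $ h $ j) has_field_derivative (A i t ** N t) $ h $ j) (at t)"
    if "t \<in> \<Omega>" for i t h j
    using row[OF that, of j] ode[OF that, of h j] by (auto simp: A_def matrix_matrix_mult_def)
  from det_constant_of_traceless[OF \<Omega>(1,2) this traceless t \<Omega>(3)]
  have detA: "det (A i t) = det (A i 0)" for i .
  have detF: "det (F t) = 1"
    using det_constant_of_traceless[OF \<Omega>(1,2) ode traceless t \<Omega>(3)] by (simp add: F0)
  have c: "det (A i t) = r 0 $ i" for i
  proof -
    consider "i = 1" | "i = 2" | "i = 3" using exhaust_3 by blast
    then show ?thesis
      unfolding detA by cases (simp_all add: det_3 A_def F0 mat_def)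
  qed
  have "r t $ j * det (F t) = (\<Sum>i\<in>UNIV. det (A i t) * F t $ i $ j)"
  proof -
    consider "j = 1" | "j = 2" | "j = 3" using exhaust_3 by blast
    then show ?thesis
      by cases (simp_all add: sum_3 det_3 A_def algebra_simps)
  qed
  then show ?thesis by (simp add: c detF)
qed

section \<open>Explicit row solutions\<close>

text \<open>
  The coefficient matrix with the logarithmic derivative of \<open>\<wp> - M\<close> as a free parameter \<open>g\<close>.
\<close>

definition frame_matrix :: "complex \<Rightarrow> complex \<Rightarrow> complex^3^3" where
  "frame_matrix a g = vector
     [vector [- g, 0, - 2 * a^2], vector [- 2 / a, 0, 0], vector [0, - 2 / a, g]]"

text \<open>
  The two nontrivial components of the row equation for \<open>\<kappa>\<close>, reduced to algebra: \<open>d\<close>, \<open>q\<close>, \<open>y\<close>, \<open>d'\<close> stand for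
  \<open>\<wp>'\<close>, \<open>p\<close>, \<open>1 / p\<close>, \<open>\<wp>''\<close>, and \<open>v\<close> for the logarithmic derivative of \<open>P exp(\<kappa> t)\<close>.
\<close>

lemma twisted_row_identities:
  fixes d q y \<kappa> M :: complex
  assumes d: "d\<^sup>2 = 4 * q ^ 3 + 12 * M * q\<^sup>2 + 16" and \<kappa>: "\<kappa>\<^sup>2 = 3 * M" and y: "q * y = 1"
  defines "d' \<equiv> 6 * q\<^sup>2 + 12 * M * q" and "v \<equiv> (d + 4) * y / 2 + \<kappa>"
  shows "2 * \<kappa> * (- d * y\<^sup>2) - (d' * y\<^sup>2 + (d + 4) * (2 * y * (- d * y\<^sup>2)))
      + (2 * \<kappa> * y - (d + 4) * y\<^sup>2) * v = - (d * y) * (2 * \<kappa> * y - (d + 4) * y\<^sup>2) - 4" (is ?first)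
    and "d' * y + (d + 4) * (- d * y\<^sup>2) + ((d + 4) * y + 2 * \<kappa>) * v
      = 4 * (2 * \<kappa> * y - (d + 4) * y\<^sup>2) + d * y * ((d + 4) * y + 2 * \<kappa>)" (is ?second)
proof -
  have v: "2 * v = (d + 4) * y + 2 * \<kappa>" by (simp add: v_def)
  have "2 * (2 * \<kappa> * (- d * y\<^sup>2) - (d' * y\<^sup>2 + (d + 4) * (2 * y * (- d * y\<^sup>2)))
      + (2 * \<kappa> * y - (d + 4) * y\<^sup>2) * v) = 2 * (- (d * y) * (2 * \<kappa> * y - (d + 4) * y\<^sup>2) - 4)"
    using d \<kappa> y v unfolding d'_def by algebra
  then show ?first by (metis mult_left_cancel zero_neq_numeral)
  have "2 * (d' * y + (d + 4) * (- d * y\<^sup>2) + ((d + 4) * y + 2 * \<kappa>) * v)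
      = 2 * (4 * (2 * \<kappa> * y - (d + 4) * y\<^sup>2) + d * y * ((d + 4) * y + 2 * \<kappa>))"
    using d \<kappa> y v unfolding d'_def by algebra
  then show ?second by (metis mult_left_cancel zero_neq_numeral)
qed

text \<open>
  The three components of the row equation for \<open>\<kappa> = 0\<close>, in the same notation; \<open>- (d + 4) y\<close> is the
  logarithmic derivative of \<open>1 / P\<^sup>2\<close>.
\<close>

lemma untwisted_row_identities:
  fixes d q y M :: complex
  assumes d: "d\<^sup>2 = 4 * q ^ 3 + 12 * M * q\<^sup>2 + 16" and y: "q * y = 1"
  shows "d - q * ((d + 4) * y) = - 4"
    and "6 * q\<^sup>2 + 12 * M * q - (d - 4) * ((d + 4) * y) = 2 * q\<^sup>2"
    and "2 * q * d - q\<^sup>2 * ((d + 4) * y) = d * q - 4 * q"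
  using assms by algebra+

context delaunay_lattice
begin

definition P :: "complex \<Rightarrow> complex \<Rightarrow> complex" where
  "P \<beta> t = \<sigma> (t + \<beta> - \<alpha>) / \<sigma> (t + \<beta>) * exp (\<zeta> \<alpha> * t)"

definition Q :: "complex \<Rightarrow> complex \<Rightarrow> complex" where
  "Q \<beta> t = \<sigma> (t + \<beta> + 2 * \<alpha>) / \<sigma> (t + \<beta>) * exp (- 2 * \<zeta> \<alpha> * t)"

lemma P_nonzero: "t + \<beta> \<in> regular \<Longrightarrow> P \<beta> t \<noteq> 0"
  using \<sigma>_nonzero by (auto simp: P_def regular_def)

lemma P_deriv:
  assumes "t + \<beta> \<in> regular"
  shows "(P \<beta> has_field_derivative (deriv wp (t + \<beta>) + 4) * (1 / p (t + \<beta>)) / 2 * P \<beta> t) (at t)"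
proof -
  have z: "t + \<beta> \<notin> L" "t + (\<beta> - \<alpha>) \<notin> L" using assms by (auto simp: regular_def add_diff_eq)
  have nz: "\<sigma> (t + \<beta>) \<noteq> 0" using z \<sigma>_nonzero by auto
  note 1 = DERIV_divide[OF \<sigma>_shift_deriv[OF z(2)] \<sigma>_shift_deriv[OF z(1)] nz]
  have 2: "((\<lambda>t. exp (\<zeta> \<alpha> * t)) has_field_derivative \<zeta> \<alpha> * exp (\<zeta> \<alpha> * t)) (at t)"
    by (auto intro!: derivative_eq_intros)
  have "(P \<beta> has_field_derivative (\<zeta> (t + (\<beta> - \<alpha>)) - \<zeta> (t + \<beta>) + \<zeta> \<alpha>) * P \<beta> t) (at t)"
    unfolding P_def[abs_def] add_diff_eq[symmetric]
    by (rule DERIV_cong[OF DERIV_mult[OF 1 2]]) (use nz in \<open>simp add: field_simps\<close>)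
  moreover have "\<zeta> (t + (\<beta> - \<alpha>)) - \<zeta> (t + \<beta>) + \<zeta> \<alpha> = (deriv wp (t + \<beta>) + 4) * (1 / p (t + \<beta>)) / 2"
    using \<zeta>_difference(1)[OF assms] by (simp add: add_diff_eq)
  ultimately show ?thesis by simp
qed

lemma Q_eq:
  assumes "t + \<beta> \<in> regular"
  shows "Q \<beta> t = 2 * \<sigma> \<alpha> ^ 6 * (deriv wp (t + \<beta>) - 4) / (P \<beta> t)\<^sup>2"
proof -
  have "exp (- 2 * \<zeta> \<alpha> * t) = 1 / (exp (\<zeta> \<alpha> * t))\<^sup>2"
    by (simp add: exp_minus field_simps power2_eq_square flip: exp_add)
  then show ?thesis
    by (simp add: Q_def P_def \<sigma>_add_double_\<alpha>[OF assms] power_mult_distrib power_divide)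
qed

text \<open>
  In a row solution \<open>(r\<^sub>1, r\<^sub>2, r\<^sub>3)\<close> the second entry determines the others:
  \<open>r\<^sub>3 = - (a / 2) r\<^sub>2'\<close> and \<open>r\<^sub>1 = (r\<^sub>2'' - g r\<^sub>2') / (4 a)\<close> with \<open>g = p' / p\<close>. Here \<open>r\<^sub>2 = P exp(\<kappa> t)\<close>.
\<close>

definition twisted_row :: "complex \<Rightarrow> complex \<Rightarrow> complex \<Rightarrow> complex \<Rightarrow> complex^3" where
  "twisted_row a \<beta> \<kappa> t = (let d = deriv wp (t + \<beta>); y = 1 / p (t + \<beta>); u = P \<beta> t * exp (\<kappa> * t)
    in vector [(2 * \<kappa> * y - (d + 4) * y\<^sup>2) * u / (2 * a), u, - (a / 4) * (((d + 4) * y + 2 * \<kappa>) * u)])"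

text \<open>
  The row solution with second entry \<open>(\<wp>' - 4) / P\<^sup>2\<close>, a constant multiple of \<open>Q\<close>.
\<close>

definition untwisted_row :: "complex \<Rightarrow> complex \<Rightarrow> complex \<Rightarrow> complex^3" where
  "untwisted_row a \<beta> t = (let d = deriv wp (t + \<beta>); q = p (t + \<beta>); v = 1 / (P \<beta> t)\<^sup>2
    in vector [- (2 / a) * (q * v), (d - 4) * v, - a * (q\<^sup>2 * v)])"

lemma twisted_row_deriv:
  assumes reg: "t + \<beta> \<in> regular" and \<kappa>: "\<kappa>\<^sup>2 = 3 * M" and a: "a \<noteq> 0"
  shows "((\<lambda>s. twisted_row a \<beta> \<kappa> s $ j) has_field_derivative
    (\<Sum>i\<in>UNIV. twisted_row a \<beta> \<kappa> t $ i *
      frame_matrix a (deriv wp (t + \<beta>) / p (t + \<beta>)) $ i $ j)) (at t)"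
proof -
  define D where "D s = deriv wp (s + \<beta>)" for s
  define Y where "Y s = 1 / p (s + \<beta>)" for s
  define u where "u s = P \<beta> s * exp (\<kappa> * s)" for s
  define d q y where "d = D t" and "q = p (t + \<beta>)" and "y = Y t"
  have z: "t + \<beta> \<notin> L" and q: "q \<noteq> 0" using reg by (auto simp: regular_iff q_def)
  have d2: "d\<^sup>2 = 4 * q ^ 3 + 12 * M * q\<^sup>2 + 16"
    unfolding d_def D_def q_def by (rule wp_deriv_squared[OF z])
  have y: "q * y = 1" using q by (simp add: y_def Y_def q_def)
  have dP: "(P \<beta> has_field_derivative (d + 4) * y / 2 * P \<beta> t) (at t)"
    using P_deriv[OF reg] unfolding d_def D_def y_def Y_def .
  have du: "(u has_field_derivative ((d + 4) * y / 2 + \<kappa>) * u t) (at t)"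
    unfolding u_def[abs_def]
    by (rule derivative_eq_intros dP refl)+ (simp add: algebra_simps)
  have dD: "(D has_field_derivative 6 * q\<^sup>2 + 12 * M * q) (at t)"
    using wp_second_deriv[OF z, unfolded DERIV_shift] by (simp add: q_def D_def[abs_def])
  have dY: "(Y has_field_derivative - d * y\<^sup>2) (at t)"
    using DERIV_divide[OF DERIV_const[of 1] p_deriv[OF z, unfolded DERIV_shift]] q
    by (simp add: d_def D_def Y_def[abs_def] y_def q_def power2_eq_square)
  note identities = twisted_row_identities[OF d2 \<kappa> y]
  have 1: "((\<lambda>s. 2 * \<kappa> * Y s - (D s + 4) * (Y s)\<^sup>2) has_field_derivative
      2 * \<kappa> * (- d * y\<^sup>2) - ((6 * q\<^sup>2 + 12 * M * q) * y\<^sup>2 + (d + 4) * (2 * y * (- d * y\<^sup>2)))) (at t)"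
    by (rule derivative_eq_intros dD dY refl)+ (simp add: d_def y_def algebra_simps)
  have 3: "((\<lambda>s. (D s + 4) * Y s + 2 * \<kappa>) has_field_derivative
      (6 * q\<^sup>2 + 12 * M * q) * y + (d + 4) * (- d * y\<^sup>2)) (at t)"
    by (rule derivative_eq_intros dD dY refl)+ (simp add: d_def y_def algebra_simps)
  have "((\<lambda>s. (2 * \<kappa> * Y s - (D s + 4) * (Y s)\<^sup>2) * u s) has_field_derivative
      (- (d * y) * (2 * \<kappa> * y - (d + 4) * y\<^sup>2) - 4) * u t) (at t)"
    by (rule DERIV_cong[OF DERIV_mult[OF 1 du]])
      (subst identities(1)[symmetric], simp add: d_def y_def field_simps)
  note row1 = DERIV_cdivide[OF this, of "2 * a"]
  have "((\<lambda>s. ((D s + 4) * Y s + 2 * \<kappa>) * u s) has_field_derivative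
      (4 * (2 * \<kappa> * y - (d + 4) * y\<^sup>2) + d * y * ((d + 4) * y + 2 * \<kappa>)) * u t) (at t)"
    by (rule DERIV_cong[OF DERIV_mult[OF 3 du]])
      (subst identities(2)[symmetric], simp add: d_def y_def field_simps)
  note row3 = DERIV_cmult[OF this, of "- (a / 4)"]
  have row: "twisted_row a \<beta> \<kappa> s = vector [(2 * \<kappa> * Y s - (D s + 4) * (Y s)\<^sup>2) * u s / (2 * a), u s,
      - (a / 4) * (((D s + 4) * Y s + 2 * \<kappa>) * u s)]" for s
    by (simp only: twisted_row_def Let_def D_def Y_def u_def)
  have g: "deriv wp (t + \<beta>) / p (t + \<beta>) = d * y" by (simp add: d_def D_def y_def Y_def)
  consider "j = 1" | "j = 2" | "j = 3" using exhaust_3 by blast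
  then show ?thesis
  proof cases
    case 1
    show ?thesis
      unfolding 1 row g vector_3
      by (rule DERIV_cong[OF row1])
        (use a in \<open>simp add: frame_matrix_def sum_3 flip: d_def y_def\<close>; simp add: field_simps)
  next
    case 2
    show ?thesis
      unfolding 2 row g vector_3
      by (rule DERIV_cong[OF du])
        (use a in \<open>simp add: frame_matrix_def sum_3 flip: d_def y_def\<close>; simp add: field_simps)
  next
    case 3
    show ?thesis
      unfolding 3 row g vector_3
      by (rule DERIV_cong[OF row3])
        (use a in \<open>simp add: frame_matrix_def sum_3 power2_eq_square[of a] flip: d_def y_def\<close>; simp add: field_simps)
  qed
qed

lemma untwisted_row_deriv:
  assumes reg: "t + \<beta> \<in> regular" and a: "a \<noteq> 0"
  shows "((\<lambda>s. untwisted_row a \<beta> s $ j) has_field_derivative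
    (\<Sum>i\<in>UNIV. untwisted_row a \<beta> t $ i *
      frame_matrix a (deriv wp (t + \<beta>) / p (t + \<beta>)) $ i $ j)) (at t)"
proof -
  define D where "D s = deriv wp (s + \<beta>)" for s
  define R where "R s = p (s + \<beta>)" for s
  define v where "v s = 1 / (P \<beta> s)\<^sup>2" for s
  define d q y where "d = D t" and "q = R t" and "y = 1 / R t"
  have z: "t + \<beta> \<notin> L" and q: "q \<noteq> 0" using reg by (auto simp: regular_iff q_def R_def)
  have d2: "d\<^sup>2 = 4 * q ^ 3 + 12 * M * q\<^sup>2 + 16"
    unfolding d_def D_def q_def R_def by (rule wp_deriv_squared[OF z])
  have y: "q * y = 1" using q by (simp add: y_def q_def)
  have P: "P \<beta> t \<noteq> 0" by (rule P_nonzero[OF reg])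
  have dP: "(P \<beta> has_field_derivative (d + 4) * y / 2 * P \<beta> t) (at t)"
    using P_deriv[OF reg] unfolding d_def D_def y_def R_def .
  have dP2: "((\<lambda>s. (P \<beta> s)\<^sup>2) has_field_derivative (d + 4) * y * (P \<beta> t)\<^sup>2) (at t)"
    by (rule derivative_eq_intros dP refl)+ (simp add: power2_eq_square)
  have P2: "(P \<beta> t)\<^sup>2 \<noteq> 0" using P by simp
  have dv: "(v has_field_derivative - ((d + 4) * y) * v t) (at t)"
    unfolding v_def[abs_def]
    by (rule DERIV_cong[OF DERIV_divide[OF DERIV_const dP2 P2]])
      (use P2 in \<open>simp only: power2_eq_square divide_simps, simp\<close>)
  have dD: "(D has_field_derivative 6 * q\<^sup>2 + 12 * M * q) (at t)"
    using wp_second_deriv[OF z, unfolded DERIV_shift] by (simp add: q_def R_def D_def[abs_def])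
  have dR: "(R has_field_derivative d) (at t)"
    using p_deriv[OF z, unfolded DERIV_shift] by (simp add: d_def D_def R_def[abs_def])
  note identities = untwisted_row_identities[OF d2 y]
  have "((\<lambda>s. R s * v s) has_field_derivative - 4 * v t) (at t)"
    by (rule DERIV_cong[OF DERIV_mult[OF dR dv]])
      (subst identities(1)[symmetric], simp add: q_def algebra_simps)
  note row1 = DERIV_cmult[OF this, of "- (2 / a)"]
  have row2: "((\<lambda>s. (D s - 4) * v s) has_field_derivative 2 * q\<^sup>2 * v t) (at t)"
    by (rule DERIV_cong[OF DERIV_mult[OF DERIV_diff[OF dD DERIV_const] dv]])
      (subst identities(2)[symmetric], simp add: d_def algebra_simps)
  have "((\<lambda>s. (R s)\<^sup>2) has_field_derivative 2 * q * d) (at t)"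
    by (rule derivative_eq_intros dR refl)+ (simp add: q_def)
  from DERIV_mult[OF this dv]
  have "((\<lambda>s. (R s)\<^sup>2 * v s) has_field_derivative (d * q - 4 * q) * v t) (at t)"
    by (rule DERIV_cong) (subst identities(3)[symmetric], simp add: q_def algebra_simps)
  note row3 = DERIV_cmult[OF this, of "- a"]
  have row: "untwisted_row a \<beta> s = vector [- (2 / a) * (R s * v s), (D s - 4) * v s, - a * ((R s)\<^sup>2 * v s)]" for s
    by (simp only: untwisted_row_def Let_def D_def R_def v_def)
  have g: "deriv wp (t + \<beta>) / p (t + \<beta>) = d * y" by (simp add: d_def D_def y_def R_def)
  consider "j = 1" | "j = 2" | "j = 3" using exhaust_3 by blast
  then show ?thesis
  proof cases
    case 1
    have "q * (d * y) = d" using y by (simp add: mult_ac)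
    show ?thesis
      unfolding 1 row g vector_3
      by (rule DERIV_cong[OF row1])
        (use a y in \<open>simp add: frame_matrix_def sum_3 flip: d_def q_def\<close>; algebra)
  next
    case 2
    show ?thesis
      unfolding 2 row g vector_3
      by (rule DERIV_cong[OF row2])
        (use a in \<open>simp add: frame_matrix_def sum_3 flip: d_def q_def\<close>)
  next
    case 3
    show ?thesis
      unfolding 3 row g vector_3
      by (rule DERIV_cong[OF row3])
        (use a y in \<open>simp add: frame_matrix_def sum_3 power2_eq_square[of a] flip: d_def q_def\<close>; algebra)
  qed
qed

end

section \<open>The surface\<close>

text \<open>
  The three hypotheses on \<open>V\<^sub>1, V\<^sub>2, V\<^sub>3\<close> are the coordinates of the column with respect to the left
  eigenvectors of \<open>X\<close>. Sum and difference of the first two, together with the third, yield \<open>V\<^sub>1 + V\<^sub>3\<close>,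
  \<open>V\<^sub>2\<close> and \<open>V\<^sub>1 - V\<^sub>3\<close>, and only these combinations enter the surface, because the entries of \<open>T\<close> are
  \<open>1\<close> and the conjugate numbers \<open>\<omega>\<close>, \<open>\<omega>\<^sup>2\<close>.
\<close>

lemma affine_coordinates_from_eigen_coordinates:
  fixes a m k r V\<^sub>1 V\<^sub>2 V\<^sub>3 Ph Qh c s \<omega> :: complex
  assumes nz: "a \<noteq> 0" "k \<noteq> 0" "m - a\<^sup>2 \<noteq> 0" "r \<noteq> 0"
    and r: "r\<^sup>2 = 3" and \<omega>: "2 * \<omega> = \<i> * r - 1" and k: "k\<^sup>2 = m\<^sup>2 - a ^ 4 - 2 / a\<^sup>2"
    and plus: "a / 2 * (k - (m + a\<^sup>2)) * V\<^sub>1 + V\<^sub>2 - a / 2 * (k + (m + a\<^sup>2)) * V\<^sub>3 = Ph * (c - \<i> * s)"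
    and minus: "a / 2 * (- k - (m + a\<^sup>2)) * V\<^sub>1 + V\<^sub>2 - a / 2 * (- k + (m + a\<^sup>2)) * V\<^sub>3 = Ph * (c + \<i> * s)"
    and zero: "V\<^sub>2 - (V\<^sub>1 + V\<^sub>3) / (a * (m - a\<^sup>2)) = Qh"
  shows "(V\<^sub>1 + V\<^sub>2 + V\<^sub>3) / r = - (2 * (m - a\<^sup>2 + 1 / a)) / (r * a * k\<^sup>2) * Ph * c
      + (m - a\<^sup>2) * (m + a\<^sup>2 + 2 / a) / (r * k\<^sup>2) * Qh" (is ?first)
    and "(\<omega> * V\<^sub>1 + V\<^sub>2 + \<omega>\<^sup>2 * V\<^sub>3) / r = (m - a\<^sup>2 - 2 / a) / (r * a * k\<^sup>2) * Ph * c
      + 1 / (a * k) * Ph * s + (m - a\<^sup>2) * (m + a\<^sup>2 - 1 / a) / (r * k\<^sup>2) * Qh" (is ?second)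
    and "(\<omega>\<^sup>2 * V\<^sub>1 + V\<^sub>2 + \<omega> * V\<^sub>3) / r = (m - a\<^sup>2 - 2 / a) / (r * a * k\<^sup>2) * Ph * c
      - 1 / (a * k) * Ph * s + (m - a\<^sup>2) * (m + a\<^sup>2 - 1 / a) / (r * k\<^sup>2) * Qh" (is ?third)
proof -
  define S D where "S = V\<^sub>1 + V\<^sub>3" and "D = V\<^sub>1 - V\<^sub>3"
  define e where "e = m - a\<^sup>2"
  have e: "e \<noteq> 0" using nz by (simp add: e_def)
  \<comment> \<open>This is \<open>k\<^sup>2 = m\<^sup>2 - a\<^sup>4 - 2 / a\<^sup>2\<close>, factored.\<close>
  have k': "a\<^sup>2 * k\<^sup>2 = a\<^sup>2 * (m + a\<^sup>2) * e - 2"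
    using nz unfolding k e_def by (simp add: field_simps eval_nat_numeral)
  have sum: "2 * V\<^sub>2 - a * (m + a\<^sup>2) * S = 2 * Ph * c"
    using arg_cong2[OF plus minus, of "(+)"] by (simp add: S_def algebra_simps)
  have diff: "a * k * D = - 2 * \<i> * Ph * s"
    using arg_cong2[OF plus minus, of "(-)"] by (simp add: D_def algebra_simps)
  have V2: "V\<^sub>2 = Qh + S / (a * e)"
    using zero by (simp add: S_def e_def algebra_simps)
  have "a * e * (2 * Qh) + S * (2 - a\<^sup>2 * (m + a\<^sup>2) * e) = a * e * (2 * Ph * c)"
    unfolding sum[symmetric] V2 using nz e by (simp add: field_simps power2_eq_square)
  then have "S * (a\<^sup>2 * k\<^sup>2) = - 2 * (a * e) * (Ph * c - Qh)"
    unfolding k' by algebra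
  then have "a * (S * (a * k\<^sup>2)) = a * (- 2 * e * (Ph * c - Qh))" by algebra
  then have "S * (a * k\<^sup>2) = - 2 * e * (Ph * c - Qh)" using nz(1) by (metis mult_left_cancel)
  then have S: "S = - (2 * e / (a * k\<^sup>2)) * (Ph * c - Qh)"
    using nz by (simp add: field_simps)
  have V2': "V\<^sub>2 = Qh - 2 / (a\<^sup>2 * k\<^sup>2) * (Ph * c - Qh)"
    unfolding V2 S using nz e by (simp add: field_simps power2_eq_square)
  have D: "D = - 2 * \<i> / (a * k) * Ph * s"
    using diff nz by (simp add: field_simps)
  have Qcoeff: "1 + 2 / (a\<^sup>2 * k\<^sup>2) = e * (m + a\<^sup>2) / k\<^sup>2"
    using k' nz by (simp add: field_simps)
  have V2'': "V\<^sub>2 = e * (m + a\<^sup>2) / k\<^sup>2 * Qh - 2 / (a\<^sup>2 * k\<^sup>2) * (Ph * c)"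
    unfolding V2' Qcoeff[symmetric] by (simp add: algebra_simps diff_divide_distrib add_divide_distrib)
  have "(S + V\<^sub>2) / r = - (2 * (m - a\<^sup>2 + 1 / a)) / (r * a * k\<^sup>2) * Ph * c
      + (m - a\<^sup>2) * (m + a\<^sup>2 + 2 / a) / (r * k\<^sup>2) * Qh"
    unfolding V2'' S e_def[symmetric] using nz by (simp add: field_simps power2_eq_square)
  then show ?first by (simp add: S_def algebra_simps)
  have \<omega>': "\<omega> = \<i> * r / 2 - 1 / 2" using \<omega> by (simp add: field_simps)
  have \<omega>2: "\<omega>\<^sup>2 = - \<i> * r / 2 - 1 / 2"
    unfolding \<omega>' using r by (simp add: power2_eq_square field_simps)
  have half: "(V\<^sub>2 - S / 2) / r = (m - a\<^sup>2 - 2 / a) / (r * a * k\<^sup>2) * Ph * c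
      + (m - a\<^sup>2) * (m + a\<^sup>2 - 1 / a) / (r * k\<^sup>2) * Qh"
    unfolding V2'' S e_def[symmetric] using nz by (simp add: field_simps power2_eq_square)
  have skew: "\<i> * r / 2 * D / r = 1 / (a * k) * Ph * s"
    unfolding D using nz by (simp add: field_simps)
  have "(\<omega> * V\<^sub>1 + V\<^sub>2 + \<omega>\<^sup>2 * V\<^sub>3) / r = (V\<^sub>2 - S / 2) / r + \<i> * r / 2 * D / r"
    unfolding \<omega>2 unfolding \<omega>' S_def D_def using nz by (simp add: field_simps)
  then show ?second unfolding half skew by simp
  have "(\<omega>\<^sup>2 * V\<^sub>1 + V\<^sub>2 + \<omega> * V\<^sub>3) / r = (V\<^sub>2 - S / 2) / r - \<i> * r / 2 * D / r"
    unfolding \<omega>2 unfolding \<omega>' S_def D_def using nz by (simp add: field_simps)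
  then show ?third unfolding half skew by simp
qed

lemma cube_root_of_unity: "2 * exp (2 * of_real pi * \<i> / 3) = \<i> * of_real (sqrt 3) - 1"
proof -
  have "exp (2 * of_real pi * \<i> / 3) = cis (2 * pi / 3)"
    by (simp add: cis_conv_exp mult_ac)
  then show ?thesis
    by (simp add: complex_eq_iff cos_120 sin_120)
qed

lemma affine_sphere_components:
  fixes a m :: real and F :: "complex \<Rightarrow> complex^3^3"
  defines "\<omega> \<equiv> exp (2 * of_real pi * \<i> / 3)"
  defines "V \<equiv> (\<lambda>j t. \<Sum>l\<in>UNIV. matexp (cscale t (delaunay_X a m)) $ j $ l * F (of_real (Re t)) $ l $ 2)"
  shows "affine_sphere a m F t $ 1 = (V 1 t + V 2 t + V 3 t) / of_real (sqrt 3)"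
    and "affine_sphere a m F t $ 2 = (\<omega> * V 1 t + V 2 t + \<omega>\<^sup>2 * V 3 t) / of_real (sqrt 3)"
    and "affine_sphere a m F t $ 3 = (\<omega>\<^sup>2 * V 1 t + V 2 t + \<omega> * V 3 t) / of_real (sqrt 3)"
  unfolding affine_sphere_def T_matrix_def cscale_def Let_def V_def \<omega>_def
  by (simp_all add: matrix_vector_mult_def matrix_matrix_mult_def sum_3 field_simps)

lemma twisted_left_eigenvector:
  fixes a m :: real and \<kappa> t :: complex
  assumes "a \<noteq> 0" and \<kappa>: "\<kappa>\<^sup>2 = of_real (m^2 - a^4 - 2 / a^2)"
  defines "l \<equiv> vector [of_real a / 2 * (\<kappa> - (m + a\<^sup>2)), 1, - (of_real a / 2) * (\<kappa> + (m + a\<^sup>2))] :: complex^3"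
  shows "(\<Sum>i\<in>UNIV. l $ i * matexp (cscale t (delaunay_X a m)) $ i $ j) = exp (- \<kappa> * t) * l $ j"
proof (rule matexp_left_eigenvector)
  define A where "A = complex_of_real a"
  define K where "K = complex_of_real m"
  have A: "A \<noteq> 0" using assms(1) by (simp add: A_def)
  have \<kappa>': "A\<^sup>2 * \<kappa>\<^sup>2 = A\<^sup>2 * K\<^sup>2 - A ^ 6 - 2"
    unfolding \<kappa> using A by (simp add: A_def K_def field_simps eval_nat_numeral)
  have l: "l $ 1 = A / 2 * (\<kappa> - (K + A\<^sup>2))" "l $ 2 = 1" "l $ 3 = - (A / 2) * (\<kappa> + (K + A\<^sup>2))"
    by (simp_all add: l_def A_def K_def)
  have X: "delaunay_X a m $ 1 $ 1 = K" "delaunay_X a m $ 1 $ 2 = - 1 / A" "delaunay_X a m $ 1 $ 3 = A\<^sup>2"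
    "delaunay_X a m $ 2 $ 1 = 1 / A" "delaunay_X a m $ 2 $ 2 = 0" "delaunay_X a m $ 2 $ 3 = - 1 / A"
    "delaunay_X a m $ 3 $ 1 = - A\<^sup>2" "delaunay_X a m $ 3 $ 2 = 1 / A" "delaunay_X a m $ 3 $ 3 = - K"
    by (simp_all add: delaunay_X_explicit A_def K_def)
  fix j :: 3
  consider "j = 1" | "j = 2" | "j = 3" using exhaust_3 by blast
  then show "(\<Sum>i\<in>UNIV. l $ i * cscale t (delaunay_X a m) $ i $ j) = - \<kappa> * t * l $ j"
  proof cases
    case 1
    have "A / 2 * (\<kappa> - (K + A\<^sup>2)) * K + 1 / A - - (A / 2) * (\<kappa> + (K + A\<^sup>2)) * A\<^sup>2
        = - \<kappa> * (A / 2 * (\<kappa> - (K + A\<^sup>2)))"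
      using A \<kappa>' by (simp add: field_simps) algebra
    from arg_cong[OF this, of "\<lambda>c. t * c"] show ?thesis
      by (simp add: 1 cscale_def sum_3 l X algebra_simps)
  next
    case 2
    show ?thesis using A by (simp add: 2 cscale_def sum_3 l X field_simps)
  next
    case 3
    have "A / 2 * (\<kappa> - (K + A\<^sup>2)) * A\<^sup>2 - 1 / A - - (A / 2) * (\<kappa> + (K + A\<^sup>2)) * K
        = - \<kappa> * (- (A / 2) * (\<kappa> + (K + A\<^sup>2)))"
      using A \<kappa>' by (simp add: field_simps) algebra
    from arg_cong[OF this, of "\<lambda>c. t * c"] show ?thesis
      by (simp add: 3 cscale_def sum_3 l X algebra_simps)
  qed
qed

lemma untwisted_left_eigenvector:
  fixes a m :: real and t :: complex
  assumes "a \<noteq> 0" "m \<noteq> a\<^sup>2"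
  defines "l \<equiv> vector [- 1 / (a * (m - a\<^sup>2)), 1, - 1 / (a * (m - a\<^sup>2))] :: complex^3"
  shows "(\<Sum>i\<in>UNIV. l $ i * matexp (cscale t (delaunay_X a m)) $ i $ j) = l $ j"
proof -
  define A where "A = complex_of_real a"
  define K where "K = complex_of_real m"
  have A: "A \<noteq> 0" using assms(1) by (simp add: A_def)
  have K: "K \<noteq> A\<^sup>2" using assms(2) unfolding A_def K_def by (metis of_real_eq_iff of_real_power)
  have l: "l $ 1 = - 1 / (A * (K - A\<^sup>2))" "l $ 2 = 1" "l $ 3 = - 1 / (A * (K - A\<^sup>2))"
    by (simp_all add: l_def A_def K_def)
  have X: "delaunay_X a m $ 1 $ 1 = K" "delaunay_X a m $ 1 $ 2 = - 1 / A" "delaunay_X a m $ 1 $ 3 = A\<^sup>2"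
    "delaunay_X a m $ 2 $ 1 = 1 / A" "delaunay_X a m $ 2 $ 2 = 0" "delaunay_X a m $ 2 $ 3 = - 1 / A"
    "delaunay_X a m $ 3 $ 1 = - A\<^sup>2" "delaunay_X a m $ 3 $ 2 = 1 / A" "delaunay_X a m $ 3 $ 3 = - K"
    by (simp_all add: delaunay_X_explicit A_def K_def)
  have "(\<Sum>i\<in>UNIV. l $ i * cscale t (delaunay_X a m) $ i $ j) = 0 * l $ j" for j
  proof -
    consider "j = 1" | "j = 2" | "j = 3" using exhaust_3 by blast
    then show ?thesis
    proof cases
      case 1
      have "(A\<^sup>2 - K) / (A * (K - A\<^sup>2)) = - (1 / A)" using A K by (simp add: field_simps power2_eq_square)
      from arg_cong[OF this, of "\<lambda>c. t * c"] show ?thesis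
        by (simp add: 1 cscale_def sum_3 l X diff_divide_distrib algebra_simps)
    next
      case 2
      show ?thesis by (simp add: 2 cscale_def sum_3 l X)
    next
      case 3
      have "(K - A\<^sup>2) / (A * (K - A\<^sup>2)) = 1 / A" using A K by (simp add: field_simps power2_eq_square)
      from arg_cong[OF this, of "\<lambda>c. t * c"] show ?thesis
        by (simp add: 3 cscale_def sum_3 l X diff_divide_distrib algebra_simps)
    qed
  qed
  from matexp_left_eigenvector[OF this] show ?thesis by simp
qed

lemma trace_frame_matrix: "trace (frame_matrix a g) = 0"
  by (simp add: trace_def sum_3 frame_matrix_def)

context delaunay_lattice
begin

context
  fixes a \<beta> :: complex and F :: "complex \<Rightarrow> complex^3^3"
  assumes a: "a \<noteq> 0" and \<beta>: "\<beta> \<in> regular" and F0: "F 0 = mat 1"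
    and F_ode: "\<And>t i j. t + \<beta> \<in> regular \<Longrightarrow> ((\<lambda>s. F s $ i $ j) has_field_derivative
      (F t ** frame_matrix a (deriv wp (t + \<beta>) / p (t + \<beta>))) $ i $ j) (at t)"
begin

text \<open>
  The domain is the plane minus a countable closed set, hence connected.
\<close>

lemma row_solution_eq_inverse_frame:
  assumes "\<And>t j. t + \<beta> \<in> regular \<Longrightarrow> ((\<lambda>s. r s $ j) has_field_derivative
      (\<Sum>i\<in>UNIV. r t $ i * frame_matrix a (deriv wp (t + \<beta>) / p (t + \<beta>)) $ i $ j)) (at t)"
    and "t + \<beta> \<in> regular"
  shows "r t $ j = (\<Sum>i\<in>UNIV. r 0 $ i * F t $ i $ j)"
proof -
  define \<Omega> where "\<Omega> = (\<lambda>t. t + \<beta>) -` regular"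
  have "open \<Omega>"
    unfolding \<Omega>_def by (intro open_vimage open_regular continuous_intros)
  have "- \<Omega> \<subseteq> (\<lambda>z. z - \<beta>) ` (- regular)"
    by (auto simp: \<Omega>_def image_iff) (metis ComplI add_diff_cancel)
  then have "countable (- \<Omega>)"
    by (rule countable_subset) (intro countable_image countable_complement_regular)
  then have "connected (UNIV - - \<Omega>)"
    by (intro connected_open_diff_countable) auto
  then have "connected \<Omega>" by (simp add: Diff_eq)
  show ?thesis
    by (rule row_solution_eq_frame[where F = F and r = r and \<Omega> = \<Omega>
          and N = "\<lambda>t. frame_matrix a (deriv wp (t + \<beta>) / p (t + \<beta>))",
        OF \<open>open \<Omega>\<close> \<open>connected \<Omega>\<close> _ F0])
      (use assms \<beta> F_ode in \<open>auto simp: \<Omega>_def trace_frame_matrix\<close>)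
qed

lemma twisted_frame_component:
  assumes "t + \<beta> \<in> regular" "\<kappa>\<^sup>2 = 3 * M"
  shows "(\<Sum>i\<in>UNIV. twisted_row a \<beta> \<kappa> 0 $ i * F t $ i $ 2) = P \<beta> t * exp (\<kappa> * t)"
  using row_solution_eq_inverse_frame[OF twisted_row_deriv[OF _ assms(2) a] assms(1), of 2]
  by (simp add: twisted_row_def Let_def)

lemma untwisted_frame_component:
  assumes "t + \<beta> \<in> regular"
  shows "(\<Sum>i\<in>UNIV. untwisted_row a \<beta> 0 $ i * F t $ i $ 2) = Q \<beta> t / (2 * \<sigma> \<alpha> ^ 6)"
  using row_solution_eq_inverse_frame[OF untwisted_row_deriv[OF _ a] assms, of 2]
    Q_eq[OF assms] \<sigma>_nonzero[OF \<alpha>_notin]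
  by (simp add: untwisted_row_def Let_def)

end

end

theorem proposition4p6:
  fixes a m M :: real
    and k \<omega>\<^sub>1 \<omega>\<^sub>2 \<alpha> \<beta> A\<^sub>1 B\<^sub>1 C\<^sub>1 D\<^sub>1 E\<^sub>1 :: complex
    and L :: "complex set"
    and wp \<zeta> \<sigma> :: "complex \<Rightarrow> complex"
    and F :: "complex \<Rightarrow> complex^3^3"
  defines "M \<equiv> (m^2 - a^4 - 2 / a^2) / 3"
    and "k \<equiv> csqrt (of_real (3 * M))"
    and "L \<equiv> period_lattice \<omega>\<^sub>1 \<omega>\<^sub>2"
    and "wp \<equiv> weierstrass_p L"
    and "\<zeta> \<equiv> weierstrass_zeta L"
    and "\<sigma> \<equiv> weierstrass_sigma L"
  defines "A\<^sub>1 \<equiv> - (of_real (2 * (m - a^2 + 1 / a)) * \<sigma> \<beta>) / (of_real (sqrt 3 * a) * k^2 * \<sigma> (\<beta> - \<alpha>))"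
    and "B\<^sub>1 \<equiv> (of_real ((m - a^2) * (m + a^2 + 2 / a)) * \<sigma> \<beta>) / (of_real (sqrt 3) * k^2 * \<sigma> (\<beta> + 2 * \<alpha>))"
    and "C\<^sub>1 \<equiv> (of_real (m - a^2 - 2 / a) * \<sigma> \<beta>) / (of_real (sqrt 3 * a) * k^2 * \<sigma> (\<beta> - \<alpha>))"
    and "D\<^sub>1 \<equiv> \<sigma> \<beta> / (of_real a * k * \<sigma> (\<beta> - \<alpha>))"
    and "E\<^sub>1 \<equiv> (of_real ((m - a^2) * (m + a^2 - 1 / a)) * \<sigma> \<beta>) / (of_real (sqrt 3) * k^2 * \<sigma> (\<beta> + 2 * \<alpha>))"
  assumes "a > 0" and "M \<noteq> 0"
    and "m \<noteq> a^2"
    and "\<omega>\<^sub>2 / \<omega>\<^sub>1 \<notin> \<real>"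
    and "\<forall>z. z \<notin> L \<longrightarrow>
           (deriv wp z)^2 = 4 * wp z ^ 3 - of_real (12 * M^2) * wp z + of_real (8 * (M^3 + 2))"
    and "\<beta> \<notin> L" and "wp \<beta> = of_real (2 / a^2 + M)" and "deriv wp \<beta> = of_real (4 * m / a^2)"
    and "\<alpha> \<notin> L" and "wp \<alpha> = of_real M" and "deriv wp \<alpha> = 4"
    and "is_inverse_frame L \<beta> M a F"
  shows "\<forall>x y :: real. of_real x \<notin> Lambda_tilde L \<beta> M \<longrightarrow>
    (let X = complex_of_real x;
         Y = complex_of_real y;
         P = \<sigma> (X + \<beta> - \<alpha>) / \<sigma> (X + \<beta>) * exp (\<zeta> \<alpha> * X);
         Q = \<sigma> (X + \<beta> + 2 * \<alpha>) / \<sigma> (X + \<beta>) * exp (- 2 * \<zeta> \<alpha> * X);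
         f = affine_sphere a m F (X + \<i> * Y)
     in f $ 1 = A\<^sub>1 * P * cos (k * Y) + B\<^sub>1 * Q \<and>
        f $ 2 = C\<^sub>1 * P * cos (k * Y) + D\<^sub>1 * P * sin (k * Y) + E\<^sub>1 * Q \<and>
        f $ 3 = C\<^sub>1 * P * cos (k * Y) - D\<^sub>1 * P * sin (k * Y) + E\<^sub>1 * Q)"
proof (intro allI impI)
  fix x y :: real
  assume x: "of_real x \<notin> Lambda_tilde L \<beta> M"
  note assms' = assms(12-)
  interpret W: delaunay_lattice \<omega>\<^sub>1 \<omega>\<^sub>2 "of_real M" \<alpha>
  proof
    show "\<omega>\<^sub>2 / \<omega>\<^sub>1 \<notin> \<real>" by fact
    show "(deriv (weierstrass_p (period_lattice \<omega>\<^sub>1 \<omega>\<^sub>2)) z)\<^sup>2 =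
        4 * weierstrass_p (period_lattice \<omega>\<^sub>1 \<omega>\<^sub>2) z ^ 3
          - 12 * (of_real M)\<^sup>2 * weierstrass_p (period_lattice \<omega>\<^sub>1 \<omega>\<^sub>2) z + 8 * ((of_real M) ^ 3 + 2)"
      if "z \<notin> period_lattice \<omega>\<^sub>1 \<omega>\<^sub>2" for z
      using assms'(5) that by (simp add: wp_def L_def)
    show "\<alpha> \<notin> period_lattice \<omega>\<^sub>1 \<omega>\<^sub>2" "weierstrass_p (period_lattice \<omega>\<^sub>1 \<omega>\<^sub>2) \<alpha> = of_real M"
      "deriv (weierstrass_p (period_lattice \<omega>\<^sub>1 \<omega>\<^sub>2)) \<alpha> = 4"
      using assms'(9-11) by (simp_all add: wp_def L_def)
  qed
  note folds = L_def[symmetric] wp_def[symmetric] \<zeta>_def[symmetric] \<sigma>_def[symmetric]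
  define A K where "A = complex_of_real a" and "K = complex_of_real m"
  have A: "A \<noteq> 0" using \<open>a > 0\<close> by (simp add: A_def)
  have KA: "K - A\<^sup>2 \<noteq> 0" using \<open>m \<noteq> a^2\<close> unfolding A_def K_def
    by (metis eq_iff_diff_eq_0 of_real_eq_iff of_real_power)
  have k2: "k\<^sup>2 = 3 * of_real M" by (simp add: k_def)
  have kM: "k\<^sup>2 = of_real (m^2 - a^4 - 2 / a^2)" by (simp add: k_def M_def)
  have k: "k \<noteq> 0" using \<open>M \<noteq> 0\<close> by (simp add: k_def)
  have p\<beta>: "W.p \<beta> = 2 / A\<^sup>2" and d\<beta>: "deriv wp \<beta> = 4 * K / A\<^sup>2"
    using assms'(7,8) by (simp_all add: W.p_def folds A_def K_def)
  have regular_iff: "t + \<beta> \<in> W.regular \<longleftrightarrow> t \<notin> Lambda_tilde L \<beta> M" for t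
    by (simp add: W.regular_iff W.p_def Lambda_tilde_def folds)
  have \<beta>reg: "\<beta> \<in> W.regular"
    using \<open>\<beta> \<notin> L\<close> A by (simp add: W.regular_iff p\<beta> folds)
  have frame: "frame_coeff L \<beta> M a t = frame_matrix A (deriv wp (t + \<beta>) / W.p (t + \<beta>))" for t
    by (simp add: frame_coeff_def frame_matrix_def Let_def W.p_def folds A_def)
  have F_ode: "((\<lambda>s. F s $ i $ j) has_field_derivative
      (F t ** frame_matrix A (deriv wp (t + \<beta>) / W.p (t + \<beta>))) $ i $ j) (at t)"
    if "t + \<beta> \<in> W.regular" for t i j
    using assms'(12) that unfolding is_inverse_frame_def frame regular_iff by blast
  have F0: "F 0 = mat 1" using assms'(12) by (simp add: is_inverse_frame_def)
  define X where "X = complex_of_real x"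
  define Y where "Y = complex_of_real y"
  define P where "P = \<sigma> (X + \<beta> - \<alpha>) / \<sigma> (X + \<beta>) * exp (\<zeta> \<alpha> * X)"
  define Q where "Q = \<sigma> (X + \<beta> + 2 * \<alpha>) / \<sigma> (X + \<beta>) * exp (- 2 * \<zeta> \<alpha> * X)"
  define P\<^sub>0 where "P\<^sub>0 = \<sigma> (\<beta> - \<alpha>) / \<sigma> \<beta>"
  define Q\<^sub>0 where "Q\<^sub>0 = \<sigma> (\<beta> + 2 * \<alpha>) / \<sigma> \<beta>"
  have P_eq: "W.P \<beta> X = P" "W.P \<beta> 0 = P\<^sub>0" and Q_eq: "W.Q \<beta> X = Q" "W.Q \<beta> 0 = Q\<^sub>0"
    by (simp_all add: W.P_def W.Q_def P_def P\<^sub>0_def Q_def Q\<^sub>0_def folds)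
  have Xreg: "X + \<beta> \<in> W.regular" using x by (simp add: regular_iff X_def)
  have \<sigma>nz: "\<sigma> \<beta> \<noteq> 0" "\<sigma> \<alpha> \<noteq> 0"
    using W.\<sigma>_nonzero assms'(6,9) by (simp_all add: folds)
  have P0: "P\<^sub>0 \<noteq> 0" using W.P_nonzero[of 0 \<beta>] \<beta>reg by (simp add: P_eq)
  have Q0: "Q\<^sub>0 = 8 * \<sigma> \<alpha> ^ 6 * (K - A\<^sup>2) / (A\<^sup>2 * P\<^sub>0\<^sup>2)"
    using W.Q_eq[of 0 \<beta>] \<beta>reg A by (simp add: Q_eq P_eq d\<beta> folds field_simps)
  \<comment> \<open>\<open>\<wp>'(\<beta>) - 4 = 4 (m - a\<^sup>2) / a\<^sup>2\<close> is nonzero, so \<open>\<beta>\<close> is not congruent to \<open>- 2 \<alpha>\<close> and division by \<open>\<sigma>(\<beta> + 2 \<alpha>)\<close> is legitimate.\<close>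
  have Q0nz: "Q\<^sub>0 \<noteq> 0" unfolding Q0 using KA \<sigma>nz P0 A by simp
  \<comment> \<open>The initial values of the row solutions are left eigenvectors of \<open>X\<close>, up to a factor.\<close>
  have twisted0: "W.twisted_row A \<beta> \<kappa> 0 $ i =
      P\<^sub>0 * vector [A / 2 * (\<kappa> - (K + A\<^sup>2)), 1, - (A / 2) * (\<kappa> + (K + A\<^sup>2))] $ i" for \<kappa> i
  proof -
    consider "i = 1" | "i = 2" | "i = 3" using exhaust_3 by blast
    then show ?thesis
      using A by cases (simp add: W.twisted_row_def Let_def P_eq p\<beta> d\<beta> folds; simp add: field_simps eval_nat_numeral)+
  qed
  have untwisted0: "W.untwisted_row A \<beta> 0 $ i = Q\<^sub>0 / (2 * \<sigma> \<alpha> ^ 6) *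
      vector [- 1 / (A * (K - A\<^sup>2)), 1, - 1 / (A * (K - A\<^sup>2))] $ i" for i
  proof -
    consider "i = 1" | "i = 2" | "i = 3" using exhaust_3 by blast
    then show ?thesis
      using A KA P0 \<sigma>nz by cases (simp add: W.untwisted_row_def Let_def P_eq p\<beta> d\<beta> Q0 folds; simp add: field_simps eval_nat_numeral)+
  qed
  define E where "E = matexp (cscale (X + \<i> * Y) (delaunay_X a m))"
  define V where "V j = (\<Sum>l\<in>UNIV. E $ j $ l * F X $ l $ 2)" for j
  have contract: "(\<Sum>j\<in>UNIV. l $ j * V j) = c * (\<Sum>h\<in>UNIV. l $ h * F X $ h $ 2)"
    if "\<And>h. (\<Sum>j\<in>UNIV. l $ j * E $ j $ h) = c * l $ h" for l :: "complex^3" and c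
  proof -
    have "(\<Sum>j\<in>UNIV. l $ j * V j) = (\<Sum>h\<in>UNIV. (\<Sum>j\<in>UNIV. l $ j * E $ j $ h) * F X $ h $ 2)"
      unfolding V_def sum_distrib_left sum_distrib_right mult.assoc by (rule sum.swap)
    then show ?thesis by (simp add: that sum_distrib_left mult.assoc)
  qed
  have twisted: "(\<Sum>j\<in>UNIV. vector [A / 2 * (\<kappa> - (K + A\<^sup>2)), 1, - (A / 2) * (\<kappa> + (K + A\<^sup>2))] $ j * V j)
      = P / P\<^sub>0 * exp (- (\<i> * (\<kappa> * Y)))" if \<kappa>: "\<kappa>\<^sup>2 = k\<^sup>2" for \<kappa>
  proof -
    let ?l = "vector [A / 2 * (\<kappa> - (K + A\<^sup>2)), 1, - (A / 2) * (\<kappa> + (K + A\<^sup>2))] :: complex^3"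
    have "(\<Sum>i\<in>UNIV. W.twisted_row A \<beta> \<kappa> 0 $ i * F X $ i $ 2) = P * exp (\<kappa> * X)"
      using W.twisted_frame_component[OF A \<beta>reg F0 F_ode[unfolded wp_def L_def] Xreg, of \<kappa>] \<kappa>
      by (simp add: k2 P_eq)
    then have component: "(\<Sum>h\<in>UNIV. ?l $ h * F X $ h $ 2) = P / P\<^sub>0 * exp (\<kappa> * X)"
      using P0 by (simp add: twisted0 mult.assoc field_simps flip: sum_distrib_left)
    have "(\<Sum>i\<in>UNIV. ?l $ i * E $ i $ h) = exp (- \<kappa> * (X + \<i> * Y)) * ?l $ h" for h
      using twisted_left_eigenvector[of a \<kappa> m "X + \<i> * Y" h] \<open>a > 0\<close> \<kappa> kM
      by (simp add: E_def A_def K_def)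
    from contract[OF this, unfolded component]
    have "(\<Sum>j\<in>UNIV. ?l $ j * V j) = exp (- \<kappa> * (X + \<i> * Y)) * (P / P\<^sub>0 * exp (\<kappa> * X))" .
    also have "\<dots> = P / P\<^sub>0 * (exp (- \<kappa> * (X + \<i> * Y)) * exp (\<kappa> * X))" by (simp add: mult_ac)
    \<comment> \<open>The growth in \<open>x\<close> cancels between the matrix exponential and the frame.\<close>
    also have "exp (- \<kappa> * (X + \<i> * Y)) * exp (\<kappa> * X) = exp (- (\<i> * (\<kappa> * Y)))"
      by (simp add: algebra_simps flip: exp_add)
    finally show ?thesis .
  qed
  have plus: "A / 2 * (k - (K + A\<^sup>2)) * V 1 + V 2 - A / 2 * (k + (K + A\<^sup>2)) * V 3
      = P / P\<^sub>0 * (cos (k * Y) - \<i> * sin (k * Y))"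
    using twisted[OF refl] exp_Euler[of "- (k * Y)"] by (simp add: sum_3)
  have minus: "A / 2 * (- k - (K + A\<^sup>2)) * V 1 + V 2 - A / 2 * (- k + (K + A\<^sup>2)) * V 3
      = P / P\<^sub>0 * (cos (k * Y) + \<i> * sin (k * Y))"
    using twisted[of "- k"] exp_Euler[of "k * Y"] by (simp add: sum_3)
  have zero: "V 2 - (V 1 + V 3) / (A * (K - A\<^sup>2)) = Q / Q\<^sub>0"
  proof -
    let ?l = "vector [- 1 / (A * (K - A\<^sup>2)), 1, - 1 / (A * (K - A\<^sup>2))] :: complex^3"
    have "(\<Sum>i\<in>UNIV. W.untwisted_row A \<beta> 0 $ i * F X $ i $ 2) = Q / (2 * \<sigma> \<alpha> ^ 6)"
      using W.untwisted_frame_component[OF A \<beta>reg F0 F_ode[unfolded wp_def L_def] Xreg]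
      by (simp add: Q_eq folds)
    then have "Q\<^sub>0 / (2 * \<sigma> \<alpha> ^ 6) * (\<Sum>h\<in>UNIV. ?l $ h * F X $ h $ 2) = Q / (2 * \<sigma> \<alpha> ^ 6)"
      by (simp only: untwisted0 sum_distrib_left mult.assoc)
    then have component: "(\<Sum>h\<in>UNIV. ?l $ h * F X $ h $ 2) = Q / Q\<^sub>0"
      using Q0nz \<sigma>nz by (simp add: field_simps)
    have "(\<Sum>i\<in>UNIV. ?l $ i * E $ i $ h) = 1 * ?l $ h" for h
      using untwisted_left_eigenvector[of a m "X + \<i> * Y" h] \<open>a > 0\<close> \<open>m \<noteq> a^2\<close>
      by (simp add: E_def A_def K_def)
    from contract[OF this, unfolded component] show ?thesis by (simp add: sum_3 add_divide_distrib diff_diff_eq)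
  qed
  have r: "complex_of_real (sqrt 3) \<noteq> 0" "(complex_of_real (sqrt 3))\<^sup>2 = 3"
    by (simp_all flip: of_real_power)
  have kKA: "k\<^sup>2 = K\<^sup>2 - A ^ 4 - 2 / A\<^sup>2" by (simp add: kM A_def K_def)
  note coordinates = affine_coordinates_from_eigen_coordinates[OF A k KA r cube_root_of_unity kKA plus minus zero]
  have A\<^sub>1: "A\<^sub>1 = - (2 * (K - A\<^sup>2 + 1 / A)) / (of_real (sqrt 3) * A * k\<^sup>2) / P\<^sub>0"
    by (simp only: A\<^sub>1_def A_def K_def P\<^sub>0_def of_real_mult of_real_add of_real_diff of_real_divide
        of_real_numeral of_real_power of_real_1 divide_divide_eq_right divide_divide_eq_left
        times_divide_eq_left minus_mult_left)
  have coefficients: "B\<^sub>1 = (K - A\<^sup>2) * (K + A\<^sup>2 + 2 / A) / (of_real (sqrt 3) * k\<^sup>2) / Q\<^sub>0"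
    "C\<^sub>1 = (K - A\<^sup>2 - 2 / A) / (of_real (sqrt 3) * A * k\<^sup>2) / P\<^sub>0"
    "D\<^sub>1 = 1 / (A * k) / P\<^sub>0"
    "E\<^sub>1 = (K - A\<^sup>2) * (K + A\<^sup>2 - 1 / A) / (of_real (sqrt 3) * k\<^sup>2) / Q\<^sub>0"
    by (simp_all add: B\<^sub>1_def C\<^sub>1_def D\<^sub>1_def E\<^sub>1_def A_def K_def P\<^sub>0_def Q\<^sub>0_def)
  have "Re (X + \<i> * Y) = x" by (simp add: X_def Y_def)
  then have V_eq: "(\<Sum>l\<in>UNIV. matexp (cscale (X + \<i> * Y) (delaunay_X a m)) $ j $ l *
      F (of_real (Re (X + \<i> * Y))) $ l $ 2) = V j" for j
    by (simp add: V_def E_def X_def)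
  have "affine_sphere a m F (X + \<i> * Y) $ 1 = A\<^sub>1 * P * cos (k * Y) + B\<^sub>1 * Q \<and>
      affine_sphere a m F (X + \<i> * Y) $ 2 = C\<^sub>1 * P * cos (k * Y) + D\<^sub>1 * P * sin (k * Y) + E\<^sub>1 * Q \<and>
      affine_sphere a m F (X + \<i> * Y) $ 3 = C\<^sub>1 * P * cos (k * Y) - D\<^sub>1 * P * sin (k * Y) + E\<^sub>1 * Q"
    unfolding affine_sphere_components V_eq coordinates A\<^sub>1 coefficients by simp
  then show "let X = complex_of_real x;
         Y = complex_of_real y;
         P = \<sigma> (X + \<beta> - \<alpha>) / \<sigma> (X + \<beta>) * exp (\<zeta> \<alpha> * X);
         Q = \<sigma> (X + \<beta> + 2 * \<alpha>) / \<sigma> (X + \<beta>) * exp (- 2 * \<zeta> \<alpha> * X);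
         f = affine_sphere a m F (X + \<i> * Y)
     in f $ 1 = A\<^sub>1 * P * cos (k * Y) + B\<^sub>1 * Q \<and>
        f $ 2 = C\<^sub>1 * P * cos (k * Y) + D\<^sub>1 * P * sin (k * Y) + E\<^sub>1 * Q \<and>
        f $ 3 = C\<^sub>1 * P * cos (k * Y) - D\<^sub>1 * P * sin (k * Y) + E\<^sub>1 * Q"
    unfolding Let_def P_def Q_def X_def Y_def .
qed

end
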